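(* Let $\{X_n\}_{n\in\mathbb{Z}}$ be a zero-mean, regular, real-valued, discrete-time wide sense stationary process with finite second moment, unit-variance innovation process $\{\nu_n\}_{n\in\mathbb{Z}}$, spectral density $S_X$, and Wold decomposition $X_n=\sum_{k=0}^\infty a_k\nu_{n-k}$. Suppose that $S_X(\lambda)>0$ for all $\lambda\in(-\tfrac12,\tfrac12]$ and that $\sum_{k=0}^\infty|a_k|<\infty$. For $p\in\mathbb{N}$ let $\overline{X}_{n,p}=\overline{\mathbb{E}}[X_n|H_{n-1}^p]$ be the best linear (minimum mean squared error) estimate of $X_n$ from $X_{n-1},\ldots,X_{n-p}$, and let $\overline{X}_n=\overline{\mathbb{E}}[X_n|H_{n-1}]$ be the best linear estimate of $X_n$ from its entire past. Let $S_{\overline{X}_p}$ and $S_{\overline{X}}$ be the spectral densities of the processes $\{\overline{X}_{n,p}\}_{n\in\mathbb{Z}}$ and $\{\overline{X}_n\}_{n\in\mathbb{Z}}$. Then $S_{\overline{X}_p}$ converges to $S_{\overline{X}}$ in $L_2$ as $p\to\infty$, i.e. $$\lim_{p\to\infty}\left(\int_{-1/2}^{1/2}\left|S_{\overline{X}_p}(\lambda)-S_{\overline{X}}(\lambda)\right|^2d\lambda\right)^{1/2}=0.$$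
   Context: All random variables are real-valued, have zero mean and lie in the Hilbert space $L_2(\mathbb{P})$ of square-integrable random variables on a probability space, with inner product $\mathbb{E}[XY]$. For a wide sense stationary (WSS) process with covariance sequence $R_k=\mathbb{E}[X_{n+k}X_n]$, the spectral density is $S(\lambda)=\sum_{k\in\mathbb{Z}}R_ke^{-2\pi i\lambda k}$, $\lambda\in(-\tfrac12,\tfrac12]$. $H_n$ denotes the closed linear span of $\{X_n,X_{n-1},X_{n-2},\ldots\}$ in $L_2(\mathbb{P})$, and $H_n^p$ denotes the linear span of $\{X_n,X_{n-1},\ldots,X_{n-p+1}\}$. $\overline{\mathbb{E}}[Y|H]$ denotes the orthogonal projection of $Y$ onto the closed subspace $H$. The process is regular (purely nondeterministic) if $\bigcap_n H_n=\{0\}$. The innovation process is $\nu_n=X_n-\overline{\mathbb{E}}[X_n|H_{n-1}]$, with $\mathbb{E}[\nu_n\nu_k]=\sigma^2\delta_{n-k}$, normalized so that $\sigma^2=1$. The Wold decomposition of a regular process is $X_n=\sum_{k=0}^\infty a_k\nu_{n-k}$ with $a_0=1$ and $\sum_{k=0}^\infty|a_k|^2<\infty$. *)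

theory Defs
  imports "HOL-Probability.Probability"
begin

definition square_integrable :: "'a measure \<Rightarrow> ('a \<Rightarrow> real) \<Rightarrow> bool" where
  "square_integrable M Y \<longleftrightarrow>
     Y \<in> borel_measurable M \<and> integrable M (\<lambda>\<omega>. (Y \<omega>)\<^sup>2)"

definition zero_mean_wss :: "'a measure \<Rightarrow> (int \<Rightarrow> 'a \<Rightarrow> real) \<Rightarrow> bool" where
  "zero_mean_wss M X \<longleftrightarrow>
     (\<forall>n. square_integrable M (X n)) \<and>
     (\<forall>n. (\<integral>\<omega>. X n \<omega> \<partial>M) = 0) \<and>
     (\<forall>k m n. (\<integral>\<omega>. X (n + k) \<omega> * X n \<omega> \<partial>M) = (\<integral>\<omega>. X (m + k) \<omega> * X m \<omega> \<partial>M))"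

text \<open>For a wide sense stationary process the base time is immaterial; time 0 is used.\<close>

definition autocov :: "'a measure \<Rightarrow> (int \<Rightarrow> 'a \<Rightarrow> real) \<Rightarrow> int \<Rightarrow> real" where
  "autocov M X k = (\<integral>\<omega>. X k \<omega> * X 0 \<omega> \<partial>M)"

text \<open>The sum is unconditional (and 0 by the convention of \<^const>\<open>infsum\<close> if the
  autocovariances are not absolutely summable). Its values are real because
  the autocovariance of a real stationary process is even.\<close>

definition spectral_density :: "'a measure \<Rightarrow> (int \<Rightarrow> 'a \<Rightarrow> real) \<Rightarrow> real \<Rightarrow> complex" where
  "spectral_density M X l =
     (\<Sum>\<^sub>\<infinity>k\<in>(UNIV :: int set).
        complex_of_real (autocov M X k) * exp (- (2 * of_real pi * \<i> * of_real l * of_int k)))"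

text \<open>Random variables are represented by functions rather than by classes modulo almost sure
  equality. The closed span below is closed under almost sure equality, the algebraic one is not.\<close>

definition rv_span :: "(int \<Rightarrow> 'a \<Rightarrow> real) \<Rightarrow> int set \<Rightarrow> ('a \<Rightarrow> real) set" where
  "rv_span X I = {(\<lambda>\<omega>. \<Sum>i\<in>F. c i * X i \<omega>) | F c. finite F \<and> F \<subseteq> I}"

definition closed_rv_span ::
  "'a measure \<Rightarrow> (int \<Rightarrow> 'a \<Rightarrow> real) \<Rightarrow> int set \<Rightarrow> ('a \<Rightarrow> real) set" where
  "closed_rv_span M X I =
     {Y. square_integrable M Y \<and>
         (\<forall>\<epsilon>>0. \<exists>Z\<in>rv_span X I. sqrt (\<integral>\<omega>. (Y \<omega> - Z \<omega>)\<^sup>2 \<partial>M) < \<epsilon>)}"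

definition past :: "'a measure \<Rightarrow> (int \<Rightarrow> 'a \<Rightarrow> real) \<Rightarrow> int \<Rightarrow> ('a \<Rightarrow> real) set" where
  "past M X n = closed_rv_span M X {..n}"

definition finite_past :: "(int \<Rightarrow> 'a \<Rightarrow> real) \<Rightarrow> nat \<Rightarrow> int \<Rightarrow> ('a \<Rightarrow> real) set" where
  "finite_past X p n = rv_span X {n - int p + 1..n}"

definition is_orth_proj ::
  "'a measure \<Rightarrow> ('a \<Rightarrow> real) set \<Rightarrow> ('a \<Rightarrow> real) \<Rightarrow> ('a \<Rightarrow> real) \<Rightarrow> bool" where
  "is_orth_proj M H Y P \<longleftrightarrow> P \<in> H \<and> (\<forall>Z\<in>H. (\<integral>\<omega>. (Y \<omega> - P \<omega>) * Z \<omega> \<partial>M) = 0)"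

text \<open>The projection onto a closed subspace is determined up to almost sure equality;
  an arbitrary version is chosen.\<close>

definition orth_proj ::
  "'a measure \<Rightarrow> ('a \<Rightarrow> real) set \<Rightarrow> ('a \<Rightarrow> real) \<Rightarrow> 'a \<Rightarrow> real" where
  "orth_proj M H Y = (SOME P. is_orth_proj M H Y P)"

definition predictor :: "'a measure \<Rightarrow> (int \<Rightarrow> 'a \<Rightarrow> real) \<Rightarrow> int \<Rightarrow> 'a \<Rightarrow> real" where
  "predictor M X n = orth_proj M (past M X (n - 1)) (X n)"

definition finite_predictor ::
  "'a measure \<Rightarrow> (int \<Rightarrow> 'a \<Rightarrow> real) \<Rightarrow> nat \<Rightarrow> int \<Rightarrow> 'a \<Rightarrow> real" where
  "finite_predictor M X p n = orth_proj M (finite_past X p (n - 1)) (X n)"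

definition regular_process :: "'a measure \<Rightarrow> (int \<Rightarrow> 'a \<Rightarrow> real) \<Rightarrow> bool" where
  "regular_process M X \<longleftrightarrow> (\<forall>Y \<in> (\<Inter>n. past M X n). AE \<omega> in M. Y \<omega> = 0)"

definition innovation :: "'a measure \<Rightarrow> (int \<Rightarrow> 'a \<Rightarrow> real) \<Rightarrow> int \<Rightarrow> 'a \<Rightarrow> real" where
  "innovation M X n = (\<lambda>\<omega>. X n \<omega> - predictor M X n \<omega>)"

text \<open>The series converges in the mean-square sense.\<close>

definition wold_decomposition ::
  "'a measure \<Rightarrow> (int \<Rightarrow> 'a \<Rightarrow> real) \<Rightarrow> (int \<Rightarrow> 'a \<Rightarrow> real) \<Rightarrow> (nat \<Rightarrow> real) \<Rightarrow> bool" where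
  "wold_decomposition M X \<nu> a \<longleftrightarrow>
     a 0 = 1 \<and> summable (\<lambda>k. \<bar>a k\<bar>\<^sup>2) \<and>
     (\<forall>n. (\<lambda>N. sqrt (\<integral>\<omega>. (X n \<omega> - (\<Sum>k<N. a k * \<nu> (n - int k) \<omega>))\<^sup>2 \<partial>M)) \<longlonglongrightarrow> 0)"

end

theory Submission
  imports Defs "HOL-Complex_Analysis.Complex_Analysis"
begin

text \<open>Write \<open>A\<close> for the transform of \<open>(a\<^sub>k)\<close>, and \<open>H\<^sub>p\<close> for the transform of the coefficients \<open>h\<^sub>p\<close> with which the
predictor from \<open>p\<close> past values weighs those values. The three spectral densities are \<open>\<bar>A\<bar>\<^sup>2\<close> for
the process, \<open>\<bar>A - 1\<bar>\<^sup>2\<close> for the predictor from the entire past (it is the Wold series without its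
leading term), and \<open>\<bar>H\<^sub>p A\<bar>\<^sup>2\<close> for the finite predictor. Since
\<open>H\<^sub>p A - (A - 1) = 1 - A (1 - H\<^sub>p)\<close>, the densities are uniformly close as soon as the
sequences \<open>w\<^sub>p = a * (\<delta> - h\<^sub>p)\<close> converge to the unit sequence \<open>\<delta>\<close> in \<open>\<ell>\<^sup>1\<close>. Mean-square convergence
of the predictors yields only \<open>\<ell>\<^sup>2\<close> convergence of \<open>w\<^sub>p\<close>, hence \<open>L\<^sub>1\<close> convergence of the densities;
the passage to \<open>\<ell>\<^sup>1\<close> is Baxter's inequality.

Baxter's inequality (\<open>baxter_inequality\<close>) is a Wiener-Hopf argument in the convolution algebra
\<open>\<ell>\<^sup>1(\<int>)\<close>: optimality of \<open>h\<^sub>p\<close> says that \<open>a\<^sup>* * a * (\<delta> - h\<^sub>p)\<close>, where \<open>a\<^sup>*\<close> is the reflection of \<open>a\<close>,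
vanishes on \<open>{1..p}\<close>, and one-sided inverses of \<open>a\<close> and \<open>a\<^sup>*\<close> turn this gap into the bound
\<open>\<parallel>w\<^sub>p - \<delta>\<parallel> \<le> C \<tau>\<^sub>p (1 + \<parallel>w\<^sub>p - \<delta>\<parallel>)\<close>, in which \<open>\<tau>\<^sub>p\<close> is the mass beyond \<open>p\<close> of the
coefficients of \<open>1 / A\<close>.

So the coefficients of \<open>1 / A\<close> have to be absolutely summable. This is the one-sided form of Wiener's
lemma (\<open>wiener_power_series_complex\<close>), proved by Newman's method, with Cauchy's estimates in the place
of Fourier coefficient bounds. Its hypothesis is that the power series of \<open>A\<close> has no zero in the
closed unit disc. On the circle that is positivity of the spectral density. Inside
(\<open>wold_transfer_nonzero_in_disc\<close>) it holds because the innovation belongs to the closed span of the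
present and past of the process: some polynomials \<open>q\<close> make all coefficients of \<open>A q - 1\<close>
uniformly as small as desired, hence also its value at a given interior point, whereas at a zero of \<open>A\<close>
this value is \<open>-1\<close>.

Projections are chosen by a choice operator, so their existence must be shown before anything is
known about the predictors: by elimination for finitely many past values
(\<open>finite_projection\<close>), and for the infinite past by completeness of the space of
square-integrable functions (\<open>L2_complete\<close>, \<open>closed_span_projection_exists\<close>).\<close>

section \<open>Convolution of absolutely summable sequences\<close>

definition conv :: "(int \<Rightarrow> 'a) \<Rightarrow> (int \<Rightarrow> 'a) \<Rightarrow> int \<Rightarrow> 'a::{real_normed_field,banach}" where
  "conv f g n = (\<Sum>\<^sub>\<infinity>k. f k * g (n - k))"

abbreviation l1 :: "(int \<Rightarrow> 'a::real_normed_vector) \<Rightarrow> bool" where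
  "l1 f \<equiv> (\<lambda>k. norm (f k)) summable_on UNIV"

definition l1_norm :: "(int \<Rightarrow> 'a::real_normed_vector) \<Rightarrow> real" where
  "l1_norm f = (\<Sum>\<^sub>\<infinity>k. norm (f k))"

definition delta :: "int \<Rightarrow> 'a::zero_neq_one" where
  "delta k = (if k = 0 then 1 else 0)"

definition reflect :: "(int \<Rightarrow> 'a) \<Rightarrow> int \<Rightarrow> 'a" where
  "reflect f k = f (- k)"

lemma abs_summable_mult_bounded:
  fixes f :: "'b \<Rightarrow> 'a::real_normed_algebra"
  assumes "(\<lambda>x. norm (f x)) summable_on A" and B: "\<And>x. norm (g x) \<le> B"
  shows "(\<lambda>x. norm (f x * g x)) summable_on A"
proof (rule Infinite_Sum.abs_summable_on_comparison_test')
  show "(\<lambda>x. norm (f x) * B) summable_on A"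
    using assms(1) by (rule summable_on_cmult_left)
  show "norm (f x * g x) \<le> norm (f x) * B" for x
    by (meson B mult_left_mono norm_ge_zero norm_mult_ineq order_trans)
qed

lemma summable_double:
  fixes f g :: "int \<Rightarrow> 'a::{real_normed_field,banach}"
  assumes "l1 f" "l1 g" and B: "\<And>n. norm (phi n) \<le> B"
  shows "(\<lambda>x. norm (case x of (i,j) \<Rightarrow> f i * g j * phi (i + j))) summable_on UNIV \<times> UNIV"
proof -
  have "(\<lambda>x. norm (case x of (i,j) \<Rightarrow> f i * g j)) summable_on UNIV \<times> UNIV"
  proof (rule Infinite_Sum.abs_summable_on_Sigma_iff[THEN iffD2], intro conjI ballI)
    show "(\<lambda>j. norm (case (i, j) of (i, j) \<Rightarrow> f i * g j)) summable_on UNIV" for i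
      using assms(2) by (simp add: norm_mult summable_on_cmult_right)
    show "(\<lambda>i. norm (\<Sum>\<^sub>\<infinity>j. norm (case (i, j) of (i, j) \<Rightarrow> f i * g j))) summable_on UNIV"
      using assms(1) by (simp add: norm_mult infsum_cmult_right' abs_mult summable_on_cmult_left)
  qed
  from abs_summable_mult_bounded[OF this, of "\<lambda>(i,j). phi (i+j)" B] B show ?thesis
    by (simp add: case_prod_unfold)
qed

text \<open>Integrating a convolution against a bounded function is a double sum over the two factors. The choice
\<open>phi = 1\<close> gives the norm bound, a translate of a third sequence gives associativity, and a character
gives the multiplication rule of the transform.\<close>

lemma conv_test:
  fixes f g :: "int \<Rightarrow> 'a::{real_normed_field,banach}"
  assumes f: "l1 f" and g: "l1 g" and B: "\<And>n. norm (phi n) \<le> B"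
  shows "(\<Sum>\<^sub>\<infinity>n. conv f g n * phi n) = (\<Sum>\<^sub>\<infinity>i. f i * (\<Sum>\<^sub>\<infinity>j. g j * phi (i + j)))"
    and "l1 (\<lambda>n. conv f g n * phi n)"
proof -
  let ?H = "\<lambda>(i,j). f i * g j * phi (i + j)"
  have H: "(\<lambda>x. norm (?H x)) summable_on UNIV \<times> UNIV"
    by (rule summable_double[OF f g B])
  \<comment> \<open>the double sum over \<open>(i, j)\<close>, arranged by the value of \<open>n = i + j\<close>\<close>
  have bij: "bij_betw (\<lambda>(n,k). (k, n - k)) UNIV (UNIV :: (int \<times> int) set)"
    by (rule bij_betwI[where g = "\<lambda>(i,j). (i + j, i)"]) auto
  define K where "K = (\<lambda>(n,k). f k * g (n - k) * phi n)"
  have HK: "?H \<circ> (\<lambda>(n,k). (k, n - k)) = K"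
    by (auto simp: K_def fun_eq_iff)
  have K: "(\<lambda>x. norm (K x)) summable_on UNIV \<times> UNIV"
  proof -
    have "(\<lambda>x. norm (?H x)) summable_on (UNIV :: (int \<times> int) set)" using H by simp
    hence "(\<lambda>x. norm (?H ((\<lambda>(n,k). (k, n - k)) x))) summable_on UNIV"
      by (subst summable_on_reindex_bij_betw[OF bij, of "\<lambda>x. norm (?H x)"])
    thus ?thesis using HK by (simp add: K_def case_prod_unfold)
  qed
  have inner: "(\<Sum>\<^sub>\<infinity>k. K (n, k)) = conv f g n * phi n" for n
    unfolding K_def conv_def by (simp add: infsum_cmult_left')
  have "(\<Sum>\<^sub>\<infinity>n. conv f g n * phi n) = (\<Sum>\<^sub>\<infinity>n. \<Sum>\<^sub>\<infinity>k. K (n, k))"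
    by (simp add: inner)
  also have "\<dots> = infsum K (UNIV \<times> UNIV)"
    using infsum_Sigma'_banach[of "\<lambda>n k. K (n,k)" UNIV "\<lambda>_. UNIV"] abs_summable_summable[OF K] by simp
  also have "\<dots> = infsum ?H UNIV"
    using infsum_reindex_bij_betw[OF bij, of ?H] by (simp add: K_def case_prod_unfold)
  also have "\<dots> = (\<Sum>\<^sub>\<infinity>i. \<Sum>\<^sub>\<infinity>j. f i * g j * phi (i + j))"
    using infsum_Sigma'_banach[of "\<lambda>n k. ?H (n,k)" UNIV "\<lambda>_. UNIV"] abs_summable_summable[OF H] by simp
  also have "\<dots> = (\<Sum>\<^sub>\<infinity>i. f i * (\<Sum>\<^sub>\<infinity>j. g j * phi (i + j)))"
    by (simp add: infsum_cmult_right' mult.assoc)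
  finally show "(\<Sum>\<^sub>\<infinity>n. conv f g n * phi n) = (\<Sum>\<^sub>\<infinity>i. f i * (\<Sum>\<^sub>\<infinity>j. g j * phi (i + j)))" .
  have k1: "(\<lambda>n. \<Sum>\<^sub>\<infinity>k. norm (K (n,k))) summable_on UNIV" and
     k2: "\<And>n. (\<lambda>k. norm (K (n,k))) summable_on UNIV"
    using Infinite_Sum.abs_summable_on_Sigma_iff[THEN iffD1, OF K]
    by (auto simp: infsum_nonneg)
  have k3: "norm (conv f g n * phi n) \<le> (\<Sum>\<^sub>\<infinity>k. norm (K (n,k)))" for n
    using norm_infsum_bound[OF k2, of n] by (simp add: inner)
  show "l1 (\<lambda>n. conv f g n * phi n)"
    using k1 k3 by (rule Infinite_Sum.abs_summable_on_comparison_test')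
qed

lemma l1_conv: "l1 f \<Longrightarrow> l1 g \<Longrightarrow> l1 (conv f g)"
  for f g :: "int \<Rightarrow> 'a::{real_normed_field,banach}"
  using conv_test(2)[of f g "\<lambda>_. 1" 1] by simp

lemma l1_norm_nonneg [simp]: "0 \<le> l1_norm f"
  unfolding l1_norm_def by (rule infsum_nonneg) simp

lemma l1_bounded:
  assumes "l1 f" shows "norm (f n) \<le> l1_norm f"
proof -
  have "(\<Sum>\<^sub>\<infinity>k\<in>{n}. norm (f k)) \<le> (\<Sum>\<^sub>\<infinity>k. norm (f k))"
    using assms by (intro infsum_mono2) auto
  thus ?thesis by (simp add: l1_norm_def)
qed

lemma l1_minus_shift: "l1 f \<Longrightarrow> l1 (\<lambda>k. f (n - k))"
  and infsum_minus_shift: "infsum h UNIV = (\<Sum>\<^sub>\<infinity>k. h (n - k))" for n :: int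
proof -
  have bij: "bij_betw (\<lambda>k. n - k) UNIV (UNIV :: int set)"
    by (rule bij_betwI[where g = "\<lambda>k. n - k"]) auto
  show "l1 f \<Longrightarrow> l1 (\<lambda>k. f (n - k))"
    using summable_on_reindex_bij_betw[OF bij, of "\<lambda>k. norm (f k)"] by simp
  show "infsum h UNIV = (\<Sum>\<^sub>\<infinity>k. h (n - k))"
    using infsum_reindex_bij_betw[OF bij, of h] by simp
qed

lemma l1_reflect: "l1 f \<Longrightarrow> l1 (reflect f)"
  using l1_minus_shift[of f 0] by (simp add: reflect_def[abs_def])

lemma l1_norm_reflect [simp]: "l1_norm (reflect f) = l1_norm f"
  unfolding l1_norm_def by (subst (2) infsum_minus_shift[of _ 0]) (simp add: reflect_def)

lemma l1_add: "l1 f \<Longrightarrow> l1 g \<Longrightarrow> l1 (\<lambda>k. f k + g k)"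
  by (rule Infinite_Sum.abs_summable_on_comparison_test'[OF summable_on_add norm_triangle_ineq])

lemma l1_diff: "l1 f \<Longrightarrow> l1 g \<Longrightarrow> l1 (\<lambda>k. f k - g k)"
  by (rule Infinite_Sum.abs_summable_on_comparison_test'[OF summable_on_add norm_triangle_ineq4])

lemma l1_norm_add: "l1 f \<Longrightarrow> l1 g \<Longrightarrow> l1_norm (\<lambda>k. f k + g k) \<le> l1_norm f + l1_norm g"
  unfolding l1_norm_def
  by (subst infsum_add[symmetric], assumption, assumption)
     (rule infsum_mono[OF l1_add summable_on_add norm_triangle_ineq])

lemma l1_norm_mono:
  assumes "l1 g" "\<And>k. norm (f k) \<le> norm (g k)"
  shows "l1 f" "l1_norm f \<le> l1_norm g"
proof -
  show "l1 f" by (rule Infinite_Sum.abs_summable_on_comparison_test'[OF assms])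
  thus "l1_norm f \<le> l1_norm g"
    unfolding l1_norm_def using assms by (auto intro!: infsum_mono)
qed

lemma conv_summable:
  fixes f g :: "int \<Rightarrow> 'a::{real_normed_field,banach}"
  assumes "l1 f" "l1 g"
  shows "l1 (\<lambda>k. f k * g (n - k))"
  using abs_summable_mult_bounded[OF assms(1), of "\<lambda>k. g (n - k)"] l1_bounded[OF assms(2)] by auto

lemma conv_norm:
  fixes f g :: "int \<Rightarrow> 'a::{real_normed_field,banach}"
  assumes f: "l1 f" and g: "l1 g"
  shows "l1_norm (conv f g) \<le> l1_norm f * l1_norm g"
proof -
  let ?f = "\<lambda>k. norm (f k)" and ?g = "\<lambda>k. norm (g k)"
  have fg: "l1 ?f" "l1 ?g" using f g by simp_all
  have "l1_norm (conv f g) \<le> (\<Sum>\<^sub>\<infinity>n. conv ?f ?g n)"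
    unfolding l1_norm_def
  proof (rule infsum_mono)
    show "(\<lambda>n. norm (conv f g n)) summable_on UNIV" using l1_conv[OF f g] .
    show "conv ?f ?g summable_on UNIV" using abs_summable_summable[OF l1_conv[OF fg]] .
    show "norm (conv f g n) \<le> conv ?f ?g n" for n
      using norm_infsum_bound[OF conv_summable[OF f g, of n]] by (simp add: conv_def norm_mult)
  qed
  also have "\<dots> = (\<Sum>\<^sub>\<infinity>i. ?f i * (\<Sum>\<^sub>\<infinity>j. ?g j))"
    using conv_test(1)[OF fg, of "\<lambda>_. 1" 1] by simp
  also have "\<dots> = l1_norm f * l1_norm g"
    by (simp add: l1_norm_def infsum_cmult_left')
  finally show ?thesis .
qed

lemma conv_commute: "conv f g = conv g f"
proof
  fix n
  show "conv f g n = conv g f n"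
    unfolding conv_def by (subst infsum_minus_shift[of _ n]) (simp add: mult.commute)
qed

lemma conv_assoc:
  fixes f g h :: "int \<Rightarrow> 'a::{real_normed_field,banach}"
  assumes "l1 f" "l1 g" "l1 h"
  shows "conv (conv f g) h = conv f (conv g h)"
proof
  fix n
  have "conv (conv f g) h n = (\<Sum>\<^sub>\<infinity>i. f i * (\<Sum>\<^sub>\<infinity>j. g j * h (n - (i + j))))"
    unfolding conv_def[of "conv f g"]
    by (rule conv_test(1)[OF assms(1,2)]) (rule l1_bounded[OF assms(3)])
  thus "conv (conv f g) h n = conv f (conv g h) n"
    by (simp add: conv_def algebra_simps)
qed

lemma conv_add_left:
  fixes f g h :: "int \<Rightarrow> 'a::{real_normed_field,banach}"
  assumes "l1 f" "l1 g" "l1 h"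
  shows "conv (\<lambda>k. f k + g k) h n = conv f h n + conv g h n"
  unfolding conv_def
  using infsum_add[OF abs_summable_summable abs_summable_summable, OF conv_summable conv_summable,
    OF assms(1,3) assms(2,3), of n n]
  by (simp add: distrib_right)

lemma conv_diff_left:
  fixes f g h :: "int \<Rightarrow> real"
  assumes "l1 f" "l1 g" "l1 h"
  shows "conv (\<lambda>k. f k - g k) h n = conv f h n - conv g h n"
  using conv_add_left[OF l1_diff[OF assms(1,2)] assms(2,3), of n] by simp

lemma conv_delta [simp]: "conv delta f = f" "conv f delta = f"
proof -
  show *: "conv delta f = f" for f :: "int \<Rightarrow> 'a"
  proof
    fix n
    have "conv delta f n = (\<Sum>\<^sub>\<infinity>k\<in>{0}. delta k * f (n - k))"
      unfolding conv_def by (rule infsum_cong_neutral) (auto simp: delta_def)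
    thus "conv delta f n = f n" by (simp add: delta_def)
  qed
  show "conv f delta = f" using *[of f] conv_commute[of f delta] by simp
qed

lemma l1_finite_support: "finite {k. f k \<noteq> 0} \<Longrightarrow> l1 f"
  by (rule finite_nonzero_values_imp_summable_on) simp

lemma l1_delta: "l1 (delta :: int \<Rightarrow> 'a::{real_normed_vector,zero_neq_one})"
  by (rule l1_finite_support) (simp add: delta_def)

lemma reflect_conv:
  "reflect (conv f g) = conv (reflect f) (reflect g)"
proof
  fix n
  show "reflect (conv f g) n = conv (reflect f) (reflect g) n"
    unfolding conv_def reflect_def
    by (subst infsum_minus_shift[of _ 0]) (simp add: algebra_simps)
qed

lemma reflect_delta [simp]: "reflect delta = delta"
  by (auto simp: reflect_def delta_def fun_eq_iff)

text \<open>Sign and period are those of the spectral density, which is thus the transform of the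
autocovariance sequence.\<close>

definition dtft :: "(int \<Rightarrow> real) \<Rightarrow> real \<Rightarrow> complex" where
  "dtft f l = (\<Sum>\<^sub>\<infinity>k. of_real (f k) * exp (- (2 * of_real pi * \<i> * of_real l * of_int k)))"

lemma norm_character [simp]:
  "norm (exp (- (2 * of_real pi * \<i> * of_real l * of_int k))) = 1"
  by simp

lemma dtft_summable:
  assumes "l1 f"
  shows "l1 (\<lambda>k. of_real (f k) * exp (- (2 * of_real pi * \<i> * of_real l * of_int k)))"
  using assms by (simp add: norm_mult)

lemma norm_dtft_le: "l1 f \<Longrightarrow> norm (dtft f l) \<le> l1_norm f"
  unfolding dtft_def l1_norm_def
  using norm_infsum_bound[OF dtft_summable, of f l] by (simp add: norm_mult)

lemma dtft_diff: "l1 f \<Longrightarrow> l1 g \<Longrightarrow> dtft (\<lambda>k. f k - g k) l = dtft f l - dtft g l"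
  unfolding dtft_def
  using infsum_add[OF abs_summable_summable abs_summable_summable, OF dtft_summable dtft_summable,
    of f "\<lambda>k. - g k" l l]
  by (simp add: left_diff_distrib infsum_uminus)

lemma dtft_delta [simp]: "dtft delta l = 1"
proof -
  have "dtft delta l = (\<Sum>\<^sub>\<infinity>k\<in>{0}. of_real (delta k) * exp (- (2 * of_real pi * \<i> * of_real l * of_int k)))"
    unfolding dtft_def by (rule infsum_cong_neutral) (auto simp: delta_def)
  thus ?thesis by (simp add: delta_def)
qed

lemma dtft_conv:
  assumes f: "l1 f" and g: "l1 g"
  shows "dtft (conv f g) l = dtft f l * dtft g l"
proof -
  let ?e = "\<lambda>k::int. exp (- (2 * of_real pi * \<i> * of_real l * of_int k))"
  let ?f = "\<lambda>k. complex_of_real (f k)" and ?g = "\<lambda>k. complex_of_real (g k)"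
  have fg: "l1 ?f" "l1 ?g" using f g by simp_all
  have c: "complex_of_real (conv f g n) = conv ?f ?g n" for n
    unfolding conv_def of_real_mult[symmetric]
    by (rule infsumI[OF has_sum_of_real, OF has_sum_infsum, OF abs_summable_summable,
          OF conv_summable, OF f g, symmetric])
  have e: "?e (i + j) = ?e i * ?e j" for i j
    by (simp flip: exp_add add: algebra_simps)
  have "dtft (conv f g) l = (\<Sum>\<^sub>\<infinity>i. ?f i * (\<Sum>\<^sub>\<infinity>j. ?g j * ?e (i + j)))"
    unfolding dtft_def c by (rule conv_test(1)[OF fg, of _ 1]) simp
  also have "\<dots> = (\<Sum>\<^sub>\<infinity>i. ?f i * ?e i * (\<Sum>\<^sub>\<infinity>j. ?g j * ?e j))"
  proof (rule infsum_cong)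
    fix i
    have "(\<Sum>\<^sub>\<infinity>j. ?g j * ?e (i + j)) = (\<Sum>\<^sub>\<infinity>j. ?e i * (?g j * ?e j))"
      unfolding e by (simp add: mult_ac)
    also have "\<dots> = ?e i * (\<Sum>\<^sub>\<infinity>j. ?g j * ?e j)" by (rule infsum_cmult_right')
    finally show "?f i * (\<Sum>\<^sub>\<infinity>j. ?g j * ?e (i + j)) = ?f i * ?e i * (\<Sum>\<^sub>\<infinity>j. ?g j * ?e j)"
      by simp
  qed
  also have "\<dots> = dtft f l * dtft g l"
    unfolding dtft_def by (simp add: infsum_cmult_left')
  finally show ?thesis .
qed

lemma dtft_reflect: "dtft (reflect f) l = cnj (dtft f l)"
proof -
  have "dtft (reflect f) l = (\<Sum>\<^sub>\<infinity>k. of_real (f k) * exp (2 * of_real pi * \<i> * of_real l * of_int k))"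
    unfolding dtft_def reflect_def by (subst infsum_minus_shift[of _ 0]) simp
  also have "\<dots> = (\<Sum>\<^sub>\<infinity>k. cnj (of_real (f k) * exp (- (2 * of_real pi * \<i> * of_real l * of_int k))))"
    by (simp add: exp_cnj)
  also have "\<dots> = cnj (dtft f l)" unfolding dtft_def by (rule infsum_cnj)
  finally show ?thesis .
qed

lemma dtft_conv_reflect:
  "l1 f \<Longrightarrow> dtft (conv f (reflect f)) l = of_real ((cmod (dtft f l))\<^sup>2)"
  using dtft_conv[OF _ l1_reflect, of f f l] by (simp add: dtft_reflect complex_norm_square del: of_real_power)

section \<open>Summable inverses of power series\<close>

text \<open>The \<open>\<ell>\<^sup>1\<close> norm cut off after the \<open>K\<close>-th coefficient. It is submultiplicative for every \<open>K\<close>,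
because a coefficient of a product involves only lower coefficients of the factors. Bounds uniform in
\<open>K\<close> can therefore be computed before summability of anything is known.\<close>

definition partial_norm :: "nat \<Rightarrow> 'a::real_normed_field fps \<Rightarrow> real" where
  "partial_norm K f = (\<Sum>k\<le>K. norm (fps_nth f k))"

lemma partial_norm_nonneg [simp]: "0 \<le> partial_norm K f"
  by (simp add: partial_norm_def sum_nonneg)

lemma partial_norm_one [simp]: "partial_norm K 1 = 1"
proof -
  have "partial_norm K (1 :: 'a fps) = (\<Sum>k\<le>K. if k = 0 then 1 else 0)"
    unfolding partial_norm_def by (rule sum.cong) auto
  thus ?thesis by simp
qed

lemma partial_norm_add: "partial_norm K (f + g) \<le> partial_norm K f + partial_norm K g"
  unfolding partial_norm_def sum.distrib[symmetric]
  by (rule sum_mono) (simp add: norm_triangle_ineq)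

lemma partial_norm_sum: "partial_norm K (sum f A) \<le> (\<Sum>i\<in>A. partial_norm K (f i))"
proof (induction A rule: infinite_finite_induct)
  case (insert x A)
  thus ?case using partial_norm_add[of K "f x" "sum f A"] by simp
qed (simp_all add: partial_norm_def)

lemma partial_norm_mult: "partial_norm K (f * g) \<le> partial_norm K f * partial_norm K g"
proof -
  have "partial_norm K (f * g) \<le> (\<Sum>k\<le>K. \<Sum>i\<le>k. norm (fps_nth f i) * norm (fps_nth g (k - i)))"
    unfolding partial_norm_def
    by (rule sum_mono) (auto simp: fps_mult_nth atLeast0AtMost norm_mult[symmetric] intro: norm_sum)
  also have "\<dots> = (\<Sum>(i,j)\<in>{(i,j). i + j \<le> K}. norm (fps_nth f i) * norm (fps_nth g j))"
    by (rule sum.triangle_reindex_eq[symmetric])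
  also have "\<dots> \<le> (\<Sum>(i,j)\<in>{..K}\<times>{..K}. norm (fps_nth f i) * norm (fps_nth g j))"
    by (rule sum_mono2) auto
  also have "\<dots> = partial_norm K f * partial_norm K g"
    unfolding partial_norm_def by (simp add: sum_product sum.cartesian_product)
  finally show ?thesis .
qed

lemma partial_norm_power: "partial_norm K (f ^ n) \<le> partial_norm K f ^ n"
proof (induction n)
  case (Suc n)
  have "partial_norm K (f ^ Suc n) \<le> partial_norm K f * partial_norm K (f ^ n)"
    by (simp add: partial_norm_mult)
  also have "\<dots> \<le> partial_norm K f * partial_norm K f ^ n"
    by (intro mult_left_mono Suc) simp
  finally show ?case by simp
qed simp

text \<open>A polynomial bounded below by \<open>d\<close> on a disc of radius \<open>r\<close> has inverse powers holomorphic there, and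
Cauchy's estimate applies. With \<open>r > 1\<close> the sum of the coefficients of the \<open>n\<close>-th inverse power grows
like \<open>(1 / d)\<^sup>n\<close>, with a constant that depends only on \<open>r\<close>; in other words the spectral radius of the
inverse in \<open>\<ell>\<^sup>1\<close> is at most its supremum.\<close>

lemma polynomial_inverse_power_coeff_bound:
  fixes c :: "nat \<Rightarrow> complex"
  assumes "0 < r" "0 < d"
    and lower: "\<And>z. cmod z \<le> r \<Longrightarrow> d \<le> cmod (\<Sum>k<N. c k * z ^ k)"
  shows "cmod (fps_nth (inverse (\<Sum>k<N. fps_const (c k) * fps_X ^ k) ^ n) j) \<le> (1 / d) ^ n / r ^ j"
proof -
  define g where "g = (\<lambda>z. \<Sum>k<N. c k * z ^ k)"
  define G where "G = (\<Sum>k<N. fps_const (c k) * fps_X ^ k)"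
  define f where "f = (\<lambda>z. inverse (g z) ^ n)"
  have nz: "g z \<noteq> 0" if "cmod z \<le> r" for z
    using lower[OF that] \<open>0 < d\<close> by (auto simp: g_def)
  have gG: "g has_fps_expansion G"
    unfolding g_def G_def by (intro fps_expansion_intros)
  have "fps_nth G 0 = g 0"
    using has_fps_expansion_imp_0_eq_fps_nth_0[OF gG] by simp
  hence G0: "fps_nth G 0 \<noteq> 0" using nz[of 0] \<open>0 < r\<close> by simp
  have fF: "f has_fps_expansion (inverse G ^ n)"
    unfolding f_def by (intro fps_expansion_intros gG G0)
  have hol: "f holomorphic_on cball 0 r"
    unfolding f_def g_def using nz by (intro holomorphic_intros) (auto simp: g_def)
  have bound: "cmod ((deriv ^^ j) f 0) \<le> fact j * (1 / d) ^ n / r ^ j"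
  proof (rule Cauchy_inequality)
    show "f holomorphic_on ball 0 r" using hol by (rule holomorphic_on_subset) auto
    show "continuous_on (cball 0 r) f" using hol by (rule holomorphic_on_imp_continuous_on)
    show "0 < r" by fact
    fix z :: complex assume "cmod (0 - z) = r"
    hence "d \<le> cmod (g z)" using lower[of z] by (simp add: g_def)
    hence "inverse (cmod (g z)) \<le> 1 / d" using le_imp_inverse_le[OF _ \<open>0 < d\<close>] by (simp add: inverse_eq_divide)
    thus "cmod (f z) \<le> (1 / d) ^ n"
      unfolding f_def by (simp add: norm_power norm_inverse power_mono)
  qed
  have "cmod (fps_nth (inverse G ^ n) j) = cmod ((deriv ^^ j) f 0) / fact j"
    using fps_nth_fps_expansion[OF fF, of j] by (simp add: norm_divide)
  also have "\<dots> \<le> (fact j * (1 / d) ^ n / r ^ j) / fact j"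
    using bound by (rule divide_right_mono) simp
  also have "\<dots> = (1 / d) ^ n / r ^ j" by simp
  finally show ?thesis by (simp add: G_def)
qed

lemma geometric_partial_sum_le:
  fixes r :: real
  assumes "1 < r"
  shows "(\<Sum>j\<le>K. 1 / r ^ j) \<le> r / (r - 1)"
proof -
  have *: "(\<lambda>j. (1 / r) ^ j) sums (1 / (1 - 1 / r))"
    using assms by (intro geometric_sums) auto
  have "(\<Sum>j\<le>K. (1 / r) ^ j) \<le> 1 / (1 - 1 / r)"
    using sum_le_suminf[OF sums_summable[OF *], of "{..K}"] sums_unique[OF *] assms by simp
  thus ?thesis using assms by (simp add: field_simps power_divide)
qed

lemma power_series_bounded_below_on_disc:
  fixes a :: "nat \<Rightarrow> complex"
  assumes sm: "summable (\<lambda>k. cmod (a k))"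
    and nz: "\<And>z. cmod z \<le> 1 \<Longrightarrow> (\<Sum>k. a k * z ^ k) \<noteq> 0"
  obtains m where "0 < m" "\<And>z. cmod z \<le> 1 \<Longrightarrow> m \<le> cmod (\<Sum>k. a k * z ^ k)"
proof -
  have "uniform_limit (cball 0 1) (\<lambda>n z. \<Sum>k<n. a k * z ^ k) (\<lambda>z. \<Sum>k. a k * z ^ k) sequentially"
    using sm by (rule Weierstrass_m_test[rotated]) 
      (auto simp: norm_mult norm_power intro!: mult_left_le power_le_one)
  hence "continuous_on (cball 0 1) (\<lambda>z. \<Sum>k. a k * z ^ k)"
    by (rule uniform_limit_theorem[rotated]) (auto intro!: continuous_intros always_eventually)
  hence "continuous_on (cball 0 1) (\<lambda>z. cmod (\<Sum>k. a k * z ^ k))"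
    by (rule continuous_on_norm)
  from continuous_attains_inf[OF compact_cball _ this]
  obtain z0 where "cmod z0 \<le> 1" "\<And>z. cmod z \<le> 1 \<Longrightarrow> cmod (\<Sum>k. a k * z0 ^ k) \<le> cmod (\<Sum>k. a k * z ^ k)"
    by (auto simp: dist_norm)
  thus ?thesis using that[of "cmod (\<Sum>k. a k * z0 ^ k)"] nz by auto
qed

text \<open>Room beyond the unit circle, at the price of a slightly smaller lower bound: radial
projection moves points of the larger disc by little.\<close>

lemma polynomial_bounded_below_on_larger_disc:
  fixes c :: "nat \<Rightarrow> complex"
  assumes "d' < d" and lower: "\<And>z. cmod z \<le> 1 \<Longrightarrow> d \<le> cmod (\<Sum>k<N. c k * z ^ k)"
  obtains r where "1 < r" "\<And>z. cmod z \<le> r \<Longrightarrow> d' \<le> cmod (\<Sum>k<N. c k * z ^ k)"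
proof -
  define g where "g = (\<lambda>z. \<Sum>k<N. c k * z ^ k)"
  have "uniformly_continuous_on (cball 0 2) g"
    unfolding g_def by (intro compact_uniformly_continuous continuous_intros) auto
  then obtain e where e: "0 < e"
    "\<And>x y. cmod x \<le> 2 \<Longrightarrow> cmod y \<le> 2 \<Longrightarrow> dist x y < e \<Longrightarrow> dist (g x) (g y) < d - d'"
    using \<open>d' < d\<close> unfolding uniformly_continuous_on_def
    by (metis diff_gt_0_iff_gt mem_cball_0)
  \<comment> \<open>the minimum keeps the larger disc inside the compact set on which \<open>e\<close> was chosen\<close>
  define r where "r = 1 + min 1 (e / 2)"
  have r: "1 < r" "r \<le> 2" "r - 1 < e" using e(1) by (auto simp: r_def min_def)
  have "d' \<le> cmod (g z)" if z: "cmod z \<le> r" for z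
  proof (cases "cmod z \<le> 1")
    case True
    thus ?thesis using lower[of z] \<open>d' < d\<close> by (simp add: g_def)
  next
    case False
    define y where "y = z / of_real (cmod z)"
    have y: "cmod y = 1" using False by (auto simp: y_def norm_divide)
    have "complex_of_real (cmod z) \<noteq> 0" using False by auto
    hence "z - y = of_real (cmod z - 1) * y" by (simp add: y_def field_simps)
    hence "cmod (z - y) = cmod z - 1" using y False by (simp add: norm_mult del: of_real_diff)
    hence "dist (g z) (g y) < d - d'" using e(2)[of z y] y z r by (simp add: dist_norm)
    moreover have "d \<le> cmod (g y)" using lower[of y] y by (simp add: g_def)
    moreover have "cmod (g y) \<le> cmod (g z) + dist (g z) (g y)"
      by (metis dist_commute dist_norm norm_triangle_sub)
    ultimately show ?thesis by linarith
  qed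
  thus ?thesis using that[OF r(1)] by (simp add: g_def)
qed

text \<open>Newman's proof of Wiener's lemma. Let \<open>\<bar>F\<bar> \<ge> m\<close> on the closed disc and let \<open>G\<close> be a partial sum of
\<open>F\<close> with \<open>\<parallel>G - F\<parallel> \<le> m / 3\<close>, so that \<open>\<bar>G\<bar> \<ge> 2 m / 3\<close> there and \<open>\<bar>G\<bar> \<ge> m / 2\<close> on a larger disc. Then \<open>1 / F\<close> is the geometric series of \<open>E = (G - F) / G\<close> divided by
\<open>G\<close>. The factor \<open>1 / G\<close> may have a large norm, but \<open>\<parallel>G\<^sup>-\<^sup>n\<parallel> \<le> C (2 / m)\<^sup>n\<close>, so that
\<open>\<parallel>E\<^sup>n\<parallel> \<le> C (2 / 3)\<^sup>n\<close> and some power \<open>E\<^sup>L\<close> has norm below \<open>1 / 2\<close>. The formal inverse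
\<open>b = 1 / F\<close> satisfies \<open>b = B + b E\<^sup>L\<close>, where \<open>B\<close> is the finite geometric sum, whence
\<open>\<parallel>b\<parallel> \<le> 2 \<parallel>B\<parallel>\<close>.\<close>

lemma wiener_power_series_complex:
  fixes a :: "nat \<Rightarrow> complex"
  assumes sm: "summable (\<lambda>k. cmod (a k))"
    and nz: "\<And>z. cmod z \<le> 1 \<Longrightarrow> (\<Sum>k. a k * z ^ k) \<noteq> 0"
  shows "summable (\<lambda>k. cmod (fps_nth (inverse (Abs_fps a)) k))"
proof -
  obtain m where m: "0 < m" "\<And>z. cmod z \<le> 1 \<Longrightarrow> m \<le> cmod (\<Sum>k. a k * z ^ k)"
    using power_series_bounded_below_on_disc[OF sm nz] by blast
  have "0 < m / 3" using m(1) by simp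
  from suminf_exist_split[OF this sm] obtain N where "norm (\<Sum>k. cmod (a (k + N))) < m / 3"
    by blast
  hence N: "(\<Sum>k. cmod (a (k + N))) < m / 3" by simp
  have smN: "summable (\<lambda>k. cmod (a (k + N)))"
    using summable_ignore_initial_segment[OF sm] .
  have sz: "summable (\<lambda>k. cmod (a k * z ^ k))" if "cmod z \<le> 1" for z
    by (rule summable_comparison_test'[OF sm, of 0])
       (use that in \<open>auto simp: norm_mult norm_power intro!: mult_left_le power_le_one\<close>)
  have g_lower: "2 * m / 3 \<le> cmod (\<Sum>k<N. a k * z ^ k)" if z: "cmod z \<le> 1" for z
  proof -
    have "(\<Sum>k. a k * z ^ k) = (\<Sum>k. a (k + N) * z ^ (k + N)) + (\<Sum>k<N. a k * z ^ k)"
      by (rule suminf_split_initial_segment[OF summable_norm_cancel[OF sz[OF z]]])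
    moreover have "cmod (\<Sum>k. a (k + N) * z ^ (k + N)) \<le> (\<Sum>k. cmod (a (k + N)))"
      using smN by (intro norm_suminf_le)
        (auto simp: norm_mult norm_power intro!: mult_left_le power_le_one z)
    ultimately show ?thesis
      using m(2)[OF z] N norm_triangle_ineq[of "\<Sum>k. a (k + N) * z ^ (k + N)" "\<Sum>k<N. a k * z ^ k"]
      by simp
  qed
  obtain r where r: "1 < r" "\<And>z. cmod z \<le> r \<Longrightarrow> m / 2 \<le> cmod (\<Sum>k<N. a k * z ^ k)"
    using polynomial_bounded_below_on_larger_disc[of "m / 2" "2 * m / 3" a N] g_lower m(1) by auto
  define F where "F = Abs_fps a"
  define G where "G = (\<Sum>k<N. fps_const (a k) * fps_X ^ k)"
  define C where "C = r / (r - 1)"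
  have C: "0 \<le> C" using r by (simp add: C_def)
  have invG: "partial_norm K (inverse G ^ n) \<le> (2 / m) ^ n * C" for K n
  proof -
    have "partial_norm K (inverse G ^ n) \<le> (\<Sum>j\<le>K. (2 / m) ^ n * (1 / r ^ j))"
      unfolding partial_norm_def
      using polynomial_inverse_power_coeff_bound[of r "m / 2" a N n] r m(1)
      by (intro sum_mono) (simp add: G_def)
    also have "\<dots> = (2 / m) ^ n * (\<Sum>j\<le>K. 1 / r ^ j)" by (simp add: sum_distrib_left)
    also have "\<dots> \<le> (2 / m) ^ n * C"
      unfolding C_def using m(1) by (intro mult_left_mono geometric_partial_sum_le r) auto
    finally show ?thesis .
  qed
  have G_nth: "fps_nth G k = (if k < N then a k else 0)" for k
    by (simp add: G_def fps_sum_nth fps_mult_left_const_nth if_distrib cong: if_cong)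
  have "a 0 \<noteq> 0" using nz[of 0] by (simp add: powser_zero)
  hence F0: "fps_nth F 0 \<noteq> 0" by (simp add: F_def)
  have G0: "fps_nth G 0 \<noteq> 0"
    using g_lower[of 0] m(1) by (cases N) (auto simp: G_nth sum.lessThan_Suc_shift simp flip: F_def)
  have T: "partial_norm K (G - F) \<le> m / 3" for K
  proof -
    have "partial_norm K (G - F) = (\<Sum>k\<le>K. if k < N then 0 else cmod (a k))"
      unfolding partial_norm_def by (rule sum.cong) (auto simp: G_nth F_def)
    also have "\<dots> \<le> (\<Sum>k<K + 1 + N. if k < N then 0 else cmod (a k))"
      by (rule sum_mono2) auto
    also have "\<dots> = (\<Sum>k<K + 1. cmod (a (k + N)))"
      using sum.atLeastLessThan_shift_bounds[of "\<lambda>k. cmod (a k)" 0 N "K + 1"]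
      by (subst sum.mono_neutral_cong_right[of _ "{N..<K + 1 + N}" _ "\<lambda>k. cmod (a k)"])
         (auto simp: atLeast0LessThan add.commute)
    also have "\<dots> \<le> (\<Sum>k. cmod (a (k + N)))"
      using smN by (intro sum_le_suminf) auto
    finally show ?thesis using N by simp
  qed
  define E where "E = (G - F) * inverse G"
  have E: "partial_norm K (E ^ n) \<le> (2 / 3) ^ n * C" for K n
  proof -
    have "partial_norm K (E ^ n) \<le> partial_norm K ((G - F) ^ n) * partial_norm K (inverse G ^ n)"
      unfolding E_def power_mult_distrib by (rule partial_norm_mult)
    also have "\<dots> \<le> (m / 3) ^ n * ((2 / m) ^ n * C)"
      using m(1) C
      by (intro mult_mono invG order_trans[OF partial_norm_power] power_mono T) auto
    also have "\<dots> = (2 / 3) ^ n * C"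
      using m(1) by (simp add: power_divide field_simps)
    finally show ?thesis .
  qed
  have "(\<lambda>n. (2 / 3 :: real) ^ n * C) \<longlonglongrightarrow> 0 * C"
    by (intro tendsto_mult LIMSEQ_realpow_zero tendsto_const) auto
  hence "\<forall>\<^sub>F n in sequentially. (2 / 3 :: real) ^ n * C < 1 / 2"
    by (intro order_tendstoD) auto
  then obtain L where L: "(2 / 3 :: real) ^ L * C < 1 / 2"
    by (auto simp: eventually_sequentially)
  define B where "B = inverse G * (\<Sum>n<L. E ^ n)"
  define b where "b = inverse F"
  have FG: "F * inverse G = 1 - E"
    using inverse_mult_eq_1'[OF G0] by (simp add: E_def algebra_simps)
  have "F * B = (1 - E) * (\<Sum>n<L. E ^ n)" by (simp add: B_def FG mult.assoc[symmetric])
  hence "F * B = 1 - E ^ L" by (simp add: one_diff_power_eq)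
  hence "b * F * B = b * (1 - E ^ L)" by (simp add: mult.assoc)
  moreover have "b * F = 1" unfolding b_def by (rule inverse_mult_eq_1[OF F0])
  ultimately have b: "b = B + b * E ^ L" by (simp add: algebra_simps)
  define D where "D = (2 / m) ^ 1 * C * (\<Sum>n<L. (2 / 3) ^ n * C)"
  have B: "partial_norm K B \<le> D" for K
  proof -
    have "partial_norm K B \<le> partial_norm K (inverse G ^ 1) * partial_norm K (\<Sum>n<L. E ^ n)"
      unfolding B_def power_one_right by (rule partial_norm_mult)
    also have "\<dots> \<le> D"
      unfolding D_def using C m(1)
      by (intro mult_mono invG order_trans[OF partial_norm_sum] sum_mono E) auto
    finally show ?thesis .
  qed
  have "partial_norm K b \<le> 2 * D" for K
  proof -
    have "partial_norm K b \<le> partial_norm K B + partial_norm K b * partial_norm K (E ^ L)"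
      using partial_norm_add[of K B "b * E ^ L"] partial_norm_mult[of K b "E ^ L"] b by simp
    also have "partial_norm K b * partial_norm K (E ^ L) \<le> partial_norm K b * (1 / 2)"
      using E[of K L] L by (intro mult_left_mono) auto
    finally show ?thesis using B[of K] by simp
  qed
  hence "(\<Sum>k\<le>K. cmod (fps_nth b k)) \<le> 2 * D" for K
    by (simp add: partial_norm_def)
  thus ?thesis
    unfolding b_def F_def by (intro bounded_imp_summable) auto
qed

text \<open>The coefficientwise real parts of the complex inverse still invert a real sequence.\<close>

lemma wiener_power_series:
  fixes a :: "nat \<Rightarrow> real"
  assumes sm: "summable (\<lambda>k. \<bar>a k\<bar>)"
    and nz: "\<And>z. cmod z \<le> 1 \<Longrightarrow> (\<Sum>k. of_real (a k) * z ^ k) \<noteq> 0"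
  obtains b where "summable (\<lambda>k. \<bar>b k\<bar>)"
    and "\<And>n. (\<Sum>i\<le>n. a i * b (n - i)) = (if n = 0 then 1 else (0 :: real))"
proof -
  define A where "A = Abs_fps (\<lambda>k. complex_of_real (a k))"
  define b where "b = (\<lambda>k. Re (fps_nth (inverse A) k))"
  have sc: "summable (\<lambda>k. cmod (fps_nth (inverse A) k))"
    unfolding A_def using wiener_power_series_complex[of "\<lambda>k. of_real (a k)"] sm nz by simp
  have "summable (\<lambda>k. \<bar>b k\<bar>)"
    by (rule summable_comparison_test'[OF sc, of 0]) (simp add: b_def abs_Re_le_cmod)
  moreover have "(\<Sum>i\<le>n. a i * b (n - i)) = (if n = 0 then 1 else 0)" for n
  proof -
    have "fps_nth A 0 \<noteq> 0" using nz[of 0] by (simp add: A_def powser_zero)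
    hence "A * inverse A = 1" by (rule inverse_mult_eq_1')
    hence "Re (fps_nth (A * inverse A) n) = (if n = 0 then 1 else 0)" by simp
    thus ?thesis by (simp add: fps_mult_nth A_def b_def atLeast0AtMost)
  qed
  ultimately show ?thesis using that by blast
qed

section \<open>Baxter's inequality\<close>

lemma conv_support:
  assumes "\<And>i. f i \<noteq> 0 \<Longrightarrow> g (n - i) \<noteq> 0 \<Longrightarrow> False"
  shows "conv f g n = 0"
proof -
  have "f i * g (n - i) = 0" for i using assms[of i] by auto
  thus ?thesis unfolding conv_def by (intro infsum_0)
qed

definition tail_above :: "nat \<Rightarrow> (int \<Rightarrow> real) \<Rightarrow> int \<Rightarrow> real" where
  "tail_above p b k = (if k > int p then b k else 0)"

lemma l1_cut: "l1 f \<Longrightarrow> l1 (\<lambda>k. if P k then f k else 0)"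
  "l1 f \<Longrightarrow> l1_norm (\<lambda>k. if P k then f k else 0) \<le> l1_norm f"
  by (rule l1_norm_mono[of f]; simp)+

lemma l1_norm_tail_tendsto_0:
  assumes "l1 b"
  shows "(\<lambda>p. l1_norm (tail_above p b)) \<longlonglongrightarrow> 0"
proof (rule LIMSEQ_I)
  fix e :: real assume "0 < e"
  define S where "S = l1_norm b"
  have "((\<lambda>k. norm (b k)) has_sum S) UNIV"
    unfolding S_def l1_norm_def using assms by (rule has_sum_infsum)
  hence "\<forall>\<^sub>F F in finite_subsets_at_top UNIV. dist (sum (\<lambda>k. norm (b k)) F) S < e"
    using \<open>0 < e\<close> by (auto simp: has_sum_def tendsto_iff)
  then obtain F where F: "finite F" "dist (sum (\<lambda>k. norm (b k)) F) S < e"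
    unfolding eventually_finite_subsets_at_top by blast
  have split: "S = (\<Sum>k\<in>F. norm (b k)) + infsum (\<lambda>k. norm (b k)) (UNIV - F)"
    unfolding S_def l1_norm_def
    using infsum_Diff[OF assms, of F] F(1) by simp
  have "norm (l1_norm (tail_above p b) - 0) < e" if p: "p \<ge> nat (Max (insert 0 F))" for p
  proof -
    have le: "k \<le> int p" if "k \<in> F" for k
    proof -
      have "k \<le> Max (insert 0 F)" using F(1) that by (intro Max_ge) auto
      thus ?thesis using p by linarith
    qed
    have "l1_norm (tail_above p b) \<le> infsum (\<lambda>k. norm (b k)) (UNIV - F)"
      unfolding l1_norm_def
    proof (rule infsum_mono_neutral)
      show "(\<lambda>k. norm (tail_above p b k)) summable_on UNIV"
        unfolding tail_above_def by (rule l1_cut(1)[OF assms])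
      show "(\<lambda>k. norm (b k)) summable_on UNIV - F"
        by (rule summable_on_subset_banach[OF assms]) simp
    qed (use le in \<open>force simp: tail_above_def\<close>)+
    also have "\<dots> < e" using F(2) split by (simp add: dist_real_def)
    finally show ?thesis by simp
  qed
  thus "\<exists>no. \<forall>p\<ge>no. norm (l1_norm (tail_above p b) - 0) < e" by blast
qed

text \<open>Put \<open>w = a * u\<close> and \<open>e = a\<^sup>* * w\<close>, where the star denotes reflection. As \<open>e\<close> vanishes on \<open>{1..p}\<close>, it
splits into a part \<open>e1\<close> on the nonpositive integers and a part \<open>e2\<close> beyond \<open>p\<close>.

The reflection of \<open>b\<close> inverts that of \<open>a\<close> and is supported on the nonpositive integers, so on the
positive integers \<open>w\<close> sees only \<open>e2\<close>. It remains to bound \<open>e2\<close>. The sequence \<open>b * e = a\<^sup>* * u\<close>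
vanishes beyond \<open>p\<close>, because \<open>u\<close> does and \<open>a\<^sup>*\<close> shifts to the left only. Hence \<open>b * e2\<close>, which
is supported beyond \<open>p\<close>, cancels the part of \<open>b * e1\<close> there; and that part uses only the coefficients
of \<open>b\<close> beyond \<open>p\<close>.\<close>

lemma baxter_inequality:
  fixes a b u :: "int \<Rightarrow> real"
  assumes a: "l1 a" and b: "l1 b" and u: "l1 u" and ab: "conv a b = delta"
    and a_supp: "\<And>k. k < 0 \<Longrightarrow> a k = 0"
    and b_supp: "\<And>k. k < 0 \<Longrightarrow> b k = 0"
    and u_supp: "\<And>k. k < 0 \<or> int p < k \<Longrightarrow> u k = 0"
    and one: "a 0 * u 0 = 1"
    and orth: "\<And>j. 1 \<le> j \<Longrightarrow> j \<le> int p \<Longrightarrow> conv (conv a (reflect a)) u j = 0"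
  defines "x \<equiv> l1_norm (\<lambda>k. conv a u k - delta k)"
  shows "x \<le> l1_norm b * (l1_norm a)\<^sup>2 * l1_norm (tail_above p b) * (1 + x)"
proof -
  define w where "w = conv a u"
  define v where "v = conv (reflect a) u"
  define e where "e = conv (reflect a) w"
  define e1 where "e1 = (\<lambda>k. if k \<le> 0 then e k else 0)"
  define e2 where "e2 = (\<lambda>k. if k > int p then e k else 0)"
  note ra = l1_reflect[OF a] and rb = l1_reflect[OF b]
  have w: "l1 w" and v: "l1 v" unfolding w_def v_def by (intro l1_conv a ra u)+
  have e: "l1 e" unfolding e_def by (intro l1_conv ra w)
  have e12: "l1 e1" "l1 e2" unfolding e1_def e2_def by (rule l1_cut(1)[OF e])+
  have ba: "conv b a = delta" using ab conv_commute[of b a] by simp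
  have e_eq: "e = conv (conv a (reflect a)) u"
    unfolding e_def w_def
    by (simp add: conv_assoc[OF ra a u, symmetric] conv_commute[of a "reflect a"])
  have e_av: "e = conv a v"
    unfolding e_eq v_def by (rule conv_assoc[OF a ra u])
  have e_split: "(\<lambda>k. e1 k + e2 k) = e"
  proof
    fix k show "e1 k + e2 k = e k"
      using orth[of k] by (auto simp: e1_def e2_def e_eq)
  qed
  have split: "conv f e k = conv f e1 k + conv f e2 k" if "l1 f" for f k
    using conv_add_left[OF e12 that, of k] by (simp add: e_split conv_commute)

  \<comment> \<open>\<open>w\<close> recovered from \<open>e\<close> by the inverse of \<open>a\<^sup>*\<close>\<close>
  have w_e: "w = conv (reflect b) e"
    unfolding e_def by (simp add: conv_assoc[OF rb ra w, symmetric] reflect_conv[symmetric] ba)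
  have "norm (w k - delta k) \<le> norm (conv (reflect b) e2 k)" for k
  proof (cases "k > 0")
    case True
    hence "conv (reflect b) e1 k = 0"
      by (intro conv_support) (use b_supp in \<open>force simp: reflect_def e1_def split: if_splits\<close>)
    hence "w k = conv (reflect b) e2 k" using split[OF rb, of k] w_e by simp
    thus ?thesis using True by (simp add: delta_def)
  next
    case False
    have "a i * u (k - i) = 0" if "i \<noteq> 0" for i
      using that False a_supp[of i] u_supp[of "k - i"] by (cases "i < 0") auto
    hence "w k = (\<Sum>\<^sub>\<infinity>i\<in>{0}. a i * u (k - i))"
      unfolding w_def conv_def by (intro infsum_cong_neutral) auto
    thus ?thesis using False one u_supp[of k] by (cases "k = 0") (auto simp: delta_def)
  qed
  hence "x \<le> l1_norm (conv (reflect b) e2)"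
    unfolding x_def w_def by (intro l1_norm_mono(2) l1_conv rb e12)
  also have "\<dots> \<le> l1_norm b * l1_norm e2"
    using conv_norm[OF rb e12(2)] by simp
  finally have x: "x \<le> l1_norm b * l1_norm e2" .

  define z where "z = conv b e2"
  have z: "l1 z" unfolding z_def by (intro l1_conv b e12)
  \<comment> \<open>\<open>v = a\<^sup>* * u\<close> recovered from \<open>e\<close> by the inverse of \<open>a\<close>\<close>
  have v_e: "v = conv b e"
    unfolding e_av by (simp add: conv_assoc[OF b a v, symmetric] ba)
  have tb: "l1 (tail_above p b)"
    unfolding tail_above_def[abs_def] by (rule l1_cut(1)[OF b])
  have "norm (z k) \<le> norm (conv (tail_above p b) e1 k)" for k
  proof (cases "k > int p")
    case True
    have "v k = 0"
      unfolding v_def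
    proof (rule conv_support)
      fix i assume "reflect a i \<noteq> 0" "u (k - i) \<noteq> 0"
      thus False using True a_supp[of "- i"] u_supp[of "k - i"] by (force simp: reflect_def)
    qed
    hence "z k = - conv b e1 k"
      using split[OF b, of k] v_e by (simp add: z_def)
    also have "conv b e1 k = conv (tail_above p b) e1 k"
      unfolding conv_def by (rule infsum_cong) (use True in \<open>auto simp: tail_above_def e1_def\<close>)
    finally show ?thesis by simp
  next
    case False
    have "z k = 0"
      unfolding z_def by (rule conv_support) (use False b_supp in \<open>force simp: e2_def\<close>)
    thus ?thesis by simp
  qed
  hence "l1_norm z \<le> l1_norm (conv (tail_above p b) e1)"
    by (intro l1_norm_mono(2) l1_conv tb e12)
  also have "\<dots> \<le> l1_norm (tail_above p b) * l1_norm e1"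
    by (rule conv_norm[OF tb e12(1)])
  also have "l1_norm e1 \<le> l1_norm e"
    unfolding e1_def by (rule l1_cut(2)[OF e])
  also have "l1_norm e \<le> l1_norm a * l1_norm w"
    using conv_norm[OF ra w] by (simp add: e_def)
  also have "l1_norm w \<le> 1 + x"
  proof -
    have "l1_norm (\<lambda>k. delta k + (w k - delta k)) \<le> l1_norm (delta :: int \<Rightarrow> real) + x"
      unfolding x_def w_def[symmetric] by (intro l1_norm_add l1_diff l1_delta w)
    moreover have "l1_norm (delta :: int \<Rightarrow> real) = 1"
    proof -
      have "l1_norm (delta :: int \<Rightarrow> real) = (\<Sum>\<^sub>\<infinity>k\<in>{0::int}. norm (delta k :: real))"
        unfolding l1_norm_def by (rule infsum_cong_neutral) (auto simp: delta_def)
      thus ?thesis by (simp add: delta_def)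
    qed
    ultimately show ?thesis by simp
  qed
  finally have z_le: "l1_norm z \<le> l1_norm (tail_above p b) * (l1_norm a * (1 + x))"
    by (simp add: mult_left_mono)
  have "e2 = conv a z"
    unfolding z_def by (simp add: conv_assoc[OF a b e12(2), symmetric] ab)
  hence "l1_norm e2 \<le> l1_norm a * l1_norm z" using conv_norm[OF a z] by simp
  also have "\<dots> \<le> l1_norm a * (l1_norm (tail_above p b) * (l1_norm a * (1 + x)))"
    by (intro mult_left_mono z_le) simp
  finally have "l1_norm b * l1_norm e2 \<le> l1_norm b * (l1_norm a * (l1_norm (tail_above p b) * (l1_norm a * (1 + x))))"
    by (rule mult_left_mono) simp
  with x show ?thesis by (simp add: power2_eq_square mult_ac)
qed

section \<open>Causal sequences\<close>

text \<open>The bridge between one-sided sequences (Wold coefficients, power series) and the convolution algebra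
on the integers.\<close>

definition causal :: "(nat \<Rightarrow> real) \<Rightarrow> int \<Rightarrow> real" where
  "causal a k = (if k < 0 then 0 else a (nat k))"

lemma causal_simps [simp]: "causal a (int n) = a n" "k < 0 \<Longrightarrow> causal a k = 0" "causal a 0 = a 0"
  by (simp_all add: causal_def)

lemma summable_on_nonneg_support:
  fixes g :: "int \<Rightarrow> 'a::real_normed_vector"
  assumes "\<And>k. k < 0 \<Longrightarrow> g k = 0"
  shows "g summable_on UNIV \<longleftrightarrow> (\<lambda>n. g (int n)) summable_on UNIV"
    and "infsum g UNIV = (\<Sum>\<^sub>\<infinity>n. g (int n))"
proof -
  have neg: "g k = 0" if "k \<notin> range int" for k
    using assms[of k] that by (metis int_nat_eq not_less rangeI)
  have "g summable_on UNIV \<longleftrightarrow> g summable_on range int"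
    by (rule summable_on_cong_neutral) (use neg in auto)
  also have "\<dots> \<longleftrightarrow> (\<lambda>n. g (int n)) summable_on UNIV"
    using summable_on_reindex[of int UNIV g] by (simp add: o_def)
  finally show "g summable_on UNIV \<longleftrightarrow> (\<lambda>n. g (int n)) summable_on UNIV" .
  have "infsum g UNIV = infsum g (range int)"
    by (rule infsum_cong_neutral) (use neg in auto)
  also have "\<dots> = (\<Sum>\<^sub>\<infinity>n. g (int n))"
    using infsum_reindex[of int UNIV g] by (simp add: o_def)
  finally show "infsum g UNIV = (\<Sum>\<^sub>\<infinity>n. g (int n))" .
qed

lemma sums_nonneg_support:
  fixes g :: "int \<Rightarrow> 'a::banach"
  assumes "l1 g" "\<And>k. k < 0 \<Longrightarrow> g k = 0"
  shows "(\<lambda>n. g (int n)) sums infsum g UNIV"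
proof -
  have "(\<lambda>n. g (int n)) summable_on UNIV"
    using summable_on_nonneg_support(1)[OF assms(2)] abs_summable_summable[OF assms(1)] by simp
  from has_sum_imp_sums[OF has_sum_infsum[OF this]] show ?thesis
    by (subst summable_on_nonneg_support(2)) (use assms(2) in auto)
qed

lemma l1_causal:
  assumes "summable (\<lambda>k. \<bar>a k\<bar>)"
  shows "l1 (causal a)"
proof -
  have "(\<lambda>n. \<bar>a n\<bar>) summable_on UNIV"
    using assms by (intro norm_summable_imp_summable_on) simp
  thus ?thesis by (subst summable_on_nonneg_support) auto
qed

lemma dtft_causal:
  assumes "summable (\<lambda>k. \<bar>a k\<bar>)"
  shows "dtft (causal a) l = (\<Sum>k. of_real (a k) * exp (- (2 * of_real pi * \<i> * of_real l)) ^ k)"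
proof -
  have "(\<lambda>n. of_real (causal a (int n)) * exp (- (2 * of_real pi * \<i> * of_real l * of_int (int n))))
          sums dtft (causal a) l"
    unfolding dtft_def
    by (rule sums_nonneg_support[OF dtft_summable[OF l1_causal[OF assms]]]) simp
  moreover have "exp (- (2 * of_real pi * \<i> * of_real l * of_int (int n)))
      = exp (- (2 * of_real pi * \<i> * of_real l)) ^ n" for n
    by (simp flip: exp_of_nat_mult add: mult_ac)
  ultimately show ?thesis by (simp add: sums_iff)
qed

lemma conv_causal_delta:
  assumes "\<And>n. (\<Sum>i\<le>n. a i * b (n - i)) = (if n = 0 then 1 else 0)"
  shows "conv (causal a) (causal b) = delta"
proof
  fix k :: int
  show "conv (causal a) (causal b) k = delta k"
  proof (cases "k < 0")
    case True
    have "conv (causal a) (causal b) k = 0"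
      by (rule conv_support) (use True in \<open>auto simp: causal_def split: if_splits\<close>)
    thus ?thesis using True by (simp add: delta_def)
  next
    case False
    then obtain n where k: "k = int n" using nonneg_int_cases[of k] by auto
    have "conv (causal a) (causal b) k = (\<Sum>\<^sub>\<infinity>i\<in>int ` {..n}. causal a i * causal b (k - i))"
      unfolding conv_def
    proof (rule infsum_cong_neutral)
      fix i assume i: "i \<in> UNIV - int ` {..n}"
      have "i < 0 \<or> k < i"
      proof (rule ccontr)
        assume "\<not> (i < 0 \<or> k < i)"
        hence "i = int (nat i)" "nat i \<in> {..n}" by (auto simp: k)
        thus False using i by blast
      qed
      thus "causal a i * causal b (k - i) = 0" by auto
    qed auto
    also have "\<dots> = (\<Sum>i\<in>int ` {..n}. causal a i * causal b (k - i))" by simp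
    also have "\<dots> = (\<Sum>i\<le>n. a i * b (n - i))"
      by (subst sum.reindex) (auto simp: k causal_def nat_diff_distrib intro!: sum.cong)
    finally show ?thesis using assms[of n] by (simp add: k delta_def)
  qed
qed

lemma conv_finite_support:
  assumes "finite F" "\<And>k. k \<notin> F \<Longrightarrow> h k = 0"
  shows "conv h f n = (\<Sum>j\<in>F. h j * f (n - j))"
    and "conv (reflect h) f n = (\<Sum>j\<in>F. h j * f (n + j))"
proof -
  have "conv h f n = (\<Sum>\<^sub>\<infinity>j\<in>F. h j * f (n - j))"
    unfolding conv_def by (rule infsum_cong_neutral) (use assms in auto)
  thus "conv h f n = (\<Sum>j\<in>F. h j * f (n - j))" using assms(1) by simp
  have "conv (reflect h) f n = (\<Sum>\<^sub>\<infinity>j. h j * f (n + j))"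
    unfolding conv_def reflect_def by (subst infsum_minus_shift[of _ 0]) simp
  also have "\<dots> = (\<Sum>\<^sub>\<infinity>j\<in>F. h j * f (n + j))"
    by (rule infsum_cong_neutral) (use assms in auto)
  finally show "conv (reflect h) f n = (\<Sum>j\<in>F. h j * f (n + j))" using assms(1) by simp
qed

text \<open>The coefficients are real, so a zero of the power series at \<open>z\<close> is also one at its conjugate, which
is the point that corresponds to the frequency \<open>Arg z / (2 \<pi>)\<close>; the principal argument lies in
exactly the half-open interval required.\<close>

lemma transfer_nonzero_on_circle:
  assumes a: "summable (\<lambda>k. \<bar>a k\<bar>)"
    and nz: "\<And>l. l \<in> {-1/2<..1/2} \<Longrightarrow> dtft (causal a) l \<noteq> 0"
    and z: "cmod z = 1"
  shows "(\<Sum>k. of_real (a k) * z ^ k) \<noteq> 0"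
proof
  assume zero: "(\<Sum>k. of_real (a k) * z ^ k) = 0"
  have "summable (\<lambda>k. of_real (a k) * z ^ k)"
    by (rule summable_norm_cancel) (use a z in \<open>simp add: norm_mult norm_power\<close>)
  hence "(\<lambda>k. of_real (a k) * z ^ k) sums 0" using zero by (metis summable_sums)
  hence "(\<lambda>k. cnj (of_real (a k) * z ^ k)) sums cnj 0" by (simp only: sums_cnj)
  hence "(\<Sum>k. of_real (a k) * cnj z ^ k) = 0" by (simp add: sums_iff)
  moreover define l where "l = Arg z / (2 * pi)"
  have "exp (- (2 * of_real pi * \<i> * of_real l)) = cnj z"
  proof -
    have "z = exp (\<i> * of_real (Arg z))"
      using Arg_eq[of z] z by (cases "z = 0") auto
    hence "cnj z = exp (cnj (\<i> * of_real (Arg z)))" by (metis exp_cnj)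
    thus ?thesis by (simp add: l_def)
  qed
  ultimately have "dtft (causal a) l = 0" by (simp add: dtft_causal[OF a])
  moreover have "l \<in> {-1/2<..1/2}"
    using mpi_less_Arg[of z] Arg_le_pi[of z] by (simp add: l_def field_simps)
  ultimately show False using nz by blast
qed

section \<open>The Hilbert space of square-integrable random variables\<close>

definition L2_inner :: "'a measure \<Rightarrow> ('a \<Rightarrow> real) \<Rightarrow> ('a \<Rightarrow> real) \<Rightarrow> real" where
  "L2_inner M f g = (\<integral>\<omega>. f \<omega> * g \<omega> \<partial>M)"

lemma L2_mult_integrable:
  assumes "square_integrable M f" "square_integrable M g"
  shows "integrable M (\<lambda>\<omega>. f \<omega> * g \<omega>)"
proof (rule Bochner_Integration.integrable_bound)
  show "integrable M (\<lambda>\<omega>. (f \<omega>)\<^sup>2 + (g \<omega>)\<^sup>2)"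
    using assms by (auto simp: square_integrable_def)
  show "(\<lambda>\<omega>. f \<omega> * g \<omega>) \<in> borel_measurable M"
    using assms by (auto simp: square_integrable_def)
  have "\<bar>x * y\<bar> \<le> x\<^sup>2 + y\<^sup>2" for x y :: real
  proof -
    have "2 * \<bar>x\<bar> * \<bar>y\<bar> \<le> \<bar>x\<bar>\<^sup>2 + \<bar>y\<bar>\<^sup>2" by (rule sum_squares_bound)
    moreover have "0 \<le> \<bar>x\<bar> * \<bar>y\<bar>" by simp
    ultimately show ?thesis unfolding abs_mult power2_abs by linarith
  qed
  thus "AE \<omega> in M. norm (f \<omega> * g \<omega>) \<le> norm ((f \<omega>)\<^sup>2 + (g \<omega>)\<^sup>2)"
    by (auto simp: abs_mult intro!: always_eventually)
qed

lemma L2_add: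
  assumes "square_integrable M f" "square_integrable M g"
  shows "square_integrable M (\<lambda>\<omega>. f \<omega> + g \<omega>)"
proof -
  have "integrable M (\<lambda>\<omega>. (f \<omega>)\<^sup>2 + (g \<omega>)\<^sup>2 + 2 * (f \<omega> * g \<omega>))"
    using assms L2_mult_integrable[OF assms] by (auto simp: square_integrable_def)
  thus ?thesis
    using assms by (auto simp: square_integrable_def power2_sum mult.assoc)
qed

lemma L2_cmult: "square_integrable M f \<Longrightarrow> square_integrable M (\<lambda>\<omega>. c * f \<omega>)"
  by (auto simp: square_integrable_def power_mult_distrib)

lemma L2_diff:
  "square_integrable M f \<Longrightarrow> square_integrable M g \<Longrightarrow> square_integrable M (\<lambda>\<omega>. f \<omega> - g \<omega>)"
  using L2_add[OF _ L2_cmult, of M f g "-1"] by simp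

lemma L2_sum:
  "(\<And>i. i \<in> F \<Longrightarrow> square_integrable M (f i)) \<Longrightarrow> square_integrable M (\<lambda>\<omega>. \<Sum>i\<in>F. f i \<omega>)"
proof (induction F rule: infinite_finite_induct)
  case (insert x F)
  thus ?case using L2_add[of M "f x" "\<lambda>\<omega>. \<Sum>i\<in>F. f i \<omega>"] by simp
qed (simp_all add: square_integrable_def)

lemma L2_lincomb:
  "(\<And>i. i \<in> F \<Longrightarrow> square_integrable M (f i)) \<Longrightarrow> square_integrable M (\<lambda>\<omega>. \<Sum>i\<in>F. c i * f i \<omega>)"
  by (intro L2_sum L2_cmult)

lemma L2_inner_commute: "L2_inner M f g = L2_inner M g f"
  by (simp add: L2_inner_def mult.commute)

lemma L2_inner_cmult_left [simp]: "L2_inner M (\<lambda>\<omega>. c * f \<omega>) g = c * L2_inner M f g"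
  by (simp add: L2_inner_def mult.assoc)

lemma L2_inner_cmult_right [simp]: "L2_inner M f (\<lambda>\<omega>. c * g \<omega>) = c * L2_inner M f g"
  by (simp add: L2_inner_def mult.left_commute[of _ c])

lemma L2_inner_diff_left:
  "square_integrable M f \<Longrightarrow> square_integrable M g \<Longrightarrow> square_integrable M h \<Longrightarrow>
    L2_inner M (\<lambda>\<omega>. f \<omega> - g \<omega>) h = L2_inner M f h - L2_inner M g h"
  unfolding L2_inner_def using Bochner_Integration.integral_diff[OF L2_mult_integrable L2_mult_integrable, of M f h g h]
  by (simp add: left_diff_distrib)

lemma L2_inner_diff_right:
  "square_integrable M f \<Longrightarrow> square_integrable M g \<Longrightarrow> square_integrable M h \<Longrightarrow>
    L2_inner M h (\<lambda>\<omega>. f \<omega> - g \<omega>) = L2_inner M h f - L2_inner M h g"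
  using L2_inner_diff_left[of M f g h] by (simp add: L2_inner_commute[of M h])

lemma L2_inner_add_left:
  "square_integrable M f \<Longrightarrow> square_integrable M g \<Longrightarrow> square_integrable M h \<Longrightarrow>
    L2_inner M (\<lambda>\<omega>. f \<omega> + g \<omega>) h = L2_inner M f h + L2_inner M g h"
  unfolding L2_inner_def using Bochner_Integration.integral_add[OF L2_mult_integrable L2_mult_integrable, of M f h g h]
  by (simp add: distrib_right)

lemma L2_inner_add_right:
  "square_integrable M f \<Longrightarrow> square_integrable M g \<Longrightarrow> square_integrable M h \<Longrightarrow>
    L2_inner M h (\<lambda>\<omega>. f \<omega> + g \<omega>) = L2_inner M h f + L2_inner M h g"
  using L2_inner_add_left[of M f g h] by (simp add: L2_inner_commute[of M h])

lemma L2_inner_lincomb_right: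
  assumes "\<And>i. i \<in> F \<Longrightarrow> square_integrable M (f i)" "square_integrable M h"
  shows "L2_inner M h (\<lambda>\<omega>. \<Sum>i\<in>F. c i * f i \<omega>) = (\<Sum>i\<in>F. c i * L2_inner M h (f i))"
proof -
  have "L2_inner M h (\<lambda>\<omega>. \<Sum>i\<in>F. c i * f i \<omega>) = (\<integral>\<omega>. (\<Sum>i\<in>F. c i * (h \<omega> * f i \<omega>)) \<partial>M)"
    by (simp add: L2_inner_def sum_distrib_left mult_ac)
  also have "\<dots> = (\<Sum>i\<in>F. c i * L2_inner M h (f i))"
    using L2_mult_integrable assms by (subst Bochner_Integration.integral_sum) (auto simp: L2_inner_def)
  finally show ?thesis .
qed

lemma L2_inner_lincomb_left:
  assumes "\<And>i. i \<in> F \<Longrightarrow> square_integrable M (f i)" "square_integrable M h"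
  shows "L2_inner M (\<lambda>\<omega>. \<Sum>i\<in>F. c i * f i \<omega>) h = (\<Sum>i\<in>F. c i * L2_inner M (f i) h)"
  using L2_inner_lincomb_right[OF assms, where c = c] by (simp add: L2_inner_commute[of M h])

lemma L2_inner_self_nonneg [simp]: "0 \<le> L2_inner M f f"
  by (simp add: L2_inner_def)

lemma L2_inner_self_zero:
  "square_integrable M f \<Longrightarrow> L2_inner M f f = 0 \<longleftrightarrow> (AE \<omega> in M. f \<omega> = 0)"
  using integral_nonneg_eq_0_iff_AE[of M "\<lambda>\<omega>. f \<omega> * f \<omega>"] L2_mult_integrable[of M f f] by (auto simp: L2_inner_def)

lemma L2_inner_cong_AE:
  assumes "square_integrable M f" "square_integrable M f'" "square_integrable M g" "square_integrable M g'"
    and "AE \<omega> in M. f \<omega> = f' \<omega>" "AE \<omega> in M. g \<omega> = g' \<omega>"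
  shows "L2_inner M f g = L2_inner M f' g'"
  unfolding L2_inner_def by (rule integral_cong_AE) (use assms in \<open>auto simp: square_integrable_def\<close>)

lemma Cauchy_Schwarz_L2:
  assumes f: "square_integrable M f" and g: "square_integrable M g"
  shows "(L2_inner M f g)\<^sup>2 \<le> L2_inner M f f * L2_inner M g g"
proof (cases "L2_inner M g g = 0")
  case True
  hence "AE \<omega> in M. g \<omega> = 0" using L2_inner_self_zero[OF g] by simp
  hence "L2_inner M f g = (\<integral>\<omega>. 0 \<partial>M)"
    unfolding L2_inner_def using f g by (intro integral_cong_AE) (auto simp: square_integrable_def)
  thus ?thesis using True by simp
next
  case False
  hence pos: "0 < L2_inner M g g" using L2_inner_self_nonneg[of M g] by linarith
  define t where "t = L2_inner M f g / L2_inner M g g"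
  have tg: "square_integrable M (\<lambda>\<omega>. t * g \<omega>)" by (rule L2_cmult[OF g])
  have "0 \<le> L2_inner M (\<lambda>\<omega>. f \<omega> - t * g \<omega>) (\<lambda>\<omega>. f \<omega> - t * g \<omega>)" by simp
  also have "\<dots> = L2_inner M f f - L2_inner M f (\<lambda>\<omega>. t * g \<omega>) - (L2_inner M (\<lambda>\<omega>. t * g \<omega>) f - L2_inner M (\<lambda>\<omega>. t * g \<omega>) (\<lambda>\<omega>. t * g \<omega>))"
    using f tg by (simp only: L2_inner_diff_left L2_inner_diff_right L2_diff)
  also have "\<dots> = L2_inner M f f - t * L2_inner M f g - (t * L2_inner M f g - t * (t * L2_inner M g g))"
    by (simp add: L2_inner_commute[of M g f])
  also have "\<dots> = L2_inner M f f - (L2_inner M f g)\<^sup>2 / L2_inner M g g"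
    using pos by (simp add: t_def power2_eq_square)
  finally show ?thesis using pos by (simp add: field_simps)
qed

lemma L2_inner_tendsto:
  assumes "\<And>n. square_integrable M (Y n)" "square_integrable M Y0" "square_integrable M Z"
    and lim: "(\<lambda>n. L2_inner M (\<lambda>\<omega>. Y0 \<omega> - Y n \<omega>) (\<lambda>\<omega>. Y0 \<omega> - Y n \<omega>)) \<longlonglongrightarrow> 0"
  shows "(\<lambda>n. L2_inner M (Y n) Z) \<longlonglongrightarrow> L2_inner M Y0 Z"
proof -
  let ?d = "\<lambda>n. L2_inner M (\<lambda>\<omega>. Y0 \<omega> - Y n \<omega>) (\<lambda>\<omega>. Y0 \<omega> - Y n \<omega>)"
  have "(\<lambda>n. sqrt (?d n * L2_inner M Z Z)) \<longlonglongrightarrow> sqrt (0 * L2_inner M Z Z)"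
    by (intro tendsto_intros lim)
  hence lim': "(\<lambda>n. sqrt (?d n * L2_inner M Z Z)) \<longlonglongrightarrow> 0" by simp
  have "norm (L2_inner M Y0 Z - L2_inner M (Y n) Z) \<le> sqrt (?d n * L2_inner M Z Z)" for n
  proof -
    have "(L2_inner M (\<lambda>\<omega>. Y0 \<omega> - Y n \<omega>) Z)\<^sup>2 \<le> ?d n * L2_inner M Z Z"
      by (intro Cauchy_Schwarz_L2 L2_diff assms)
    hence "\<bar>L2_inner M (\<lambda>\<omega>. Y0 \<omega> - Y n \<omega>) Z\<bar> \<le> sqrt (?d n * L2_inner M Z Z)"
      by (rule real_le_rsqrt[of "\<bar>_\<bar>", unfolded power2_abs])
    thus ?thesis using L2_inner_diff_left[of M Y0 "Y n" Z] assms by simp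
  qed
  hence "(\<lambda>n. L2_inner M Y0 Z - L2_inner M (Y n) Z) \<longlonglongrightarrow> 0"
    by (intro Lim_null_comparison[OF _ lim'] always_eventually) auto
  thus ?thesis
    using tendsto_diff[OF tendsto_const[of "L2_inner M Y0 Z"]] by fastforce
qed

text \<open>Gram-Schmidt elimination, one variable at a time. With \<open>r\<close> and \<open>e\<close> the residuals of \<open>Y\<close> and of the new
variable after projection on the old ones, the new residual is \<open>r - t e\<close> with \<open>t = (r, e) / (e, e)\<close>.
The variables may be linearly dependent: if \<open>e\<close> is almost surely zero, then \<open>t = 0\<close> by division by
zero, and the residual \<open>r\<close> is already orthogonal to everything.\<close>

lemma finite_projection:
  assumes "finite F" "\<And>i. i \<in> F \<Longrightarrow> square_integrable M (X i)" "square_integrable M Y"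
  shows "\<exists>c. \<forall>j\<in>F. L2_inner M (\<lambda>\<omega>. Y \<omega> - (\<Sum>i\<in>F. c i * X i \<omega>)) (X j) = 0"
  using assms
proof (induction F arbitrary: Y rule: finite_induct)
  case (insert x F)
  have X: "square_integrable M (X x)" "\<And>i. i \<in> F \<Longrightarrow> square_integrable M (X i)"
    and Y: "square_integrable M Y" using insert.prems by auto
  obtain c where c: "\<And>j. j \<in> F \<Longrightarrow> L2_inner M (\<lambda>\<omega>. X x \<omega> - (\<Sum>i\<in>F. c i * X i \<omega>)) (X j) = 0"
    using insert.IH[OF X(2,1)] by blast
  obtain d where d: "\<And>j. j \<in> F \<Longrightarrow> L2_inner M (\<lambda>\<omega>. Y \<omega> - (\<Sum>i\<in>F. d i * X i \<omega>)) (X j) = 0"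
    using insert.IH[OF X(2) Y] by blast
  define e where "e = (\<lambda>\<omega>. X x \<omega> - (\<Sum>i\<in>F. c i * X i \<omega>))"
  define r where "r = (\<lambda>\<omega>. Y \<omega> - (\<Sum>i\<in>F. d i * X i \<omega>))"
  define t where "t = L2_inner M r e / L2_inner M e e"
  define res where "res = (\<lambda>\<omega>. r \<omega> - t * e \<omega>)"
  have e: "square_integrable M e" and r: "square_integrable M r"
    unfolding e_def r_def by (intro L2_diff L2_lincomb X Y; assumption)+
  note te = L2_cmult[OF e, of t]
  have res: "square_integrable M res" unfolding res_def by (rule L2_diff[OF r te])
  have F: "L2_inner M res (X j) = 0" if "j \<in> F" for j
    using L2_inner_diff_left[OF r te X(2)[OF that]] c[OF that] d[OF that]
    unfolding res_def e_def[symmetric] r_def[symmetric] by simp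
  have "L2_inner M res e = L2_inner M r e - t * L2_inner M e e"
    using L2_inner_diff_left[OF r te e] by (simp add: res_def)
  also have "\<dots> = 0"
    using Cauchy_Schwarz_L2[OF r e] by (cases "L2_inner M e e = 0") (auto simp: t_def)
  finally have "L2_inner M res e = 0" .
  moreover have "X x = (\<lambda>\<omega>. e \<omega> + (\<Sum>i\<in>F. c i * X i \<omega>))" by (simp add: e_def)
  ultimately have x: "L2_inner M res (X x) = 0"
    using L2_inner_add_right[OF e L2_lincomb[OF X(2)] res, of F "\<lambda>i. i" c] L2_inner_lincomb_right[OF X(2) res, of F "\<lambda>i. i" c] F
    by simp
  define b where "b = (\<lambda>i. if i = x then t else d i - t * c i)"
  have "(\<Sum>i\<in>insert x F. b i * X i \<omega>) = t * X x \<omega> + (\<Sum>i\<in>F. (d i - t * c i) * X i \<omega>)" for \<omega>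
    using insert.hyps by (auto simp: b_def intro!: sum.cong)
  hence "(\<lambda>\<omega>. Y \<omega> - (\<Sum>i\<in>insert x F. b i * X i \<omega>)) = res"
    by (auto simp: res_def r_def e_def fun_eq_iff algebra_simps sum.distrib sum_subtractf sum_distrib_left)
  thus ?case using F x by (intro exI[of _ b]) auto
qed simp

text \<open>Riesz-Fischer. Along a subsequence with increments of norm at most \<open>2\<^sup>-\<^sup>k\<close> the sum of the
increments converges absolutely almost everywhere; Fatou's lemma bounds the distance of the sequence
to the pointwise limit.\<close>

lemma (in prob_space) L2_complete:
  fixes Y :: "nat \<Rightarrow> 'a \<Rightarrow> real"
  assumes Y: "\<And>i. square_integrable M (Y i)"
    and cauchy: "\<And>e. 0 < e \<Longrightarrow>
      \<exists>N. \<forall>i\<ge>N. \<forall>j\<ge>N. L2_inner M (\<lambda>\<omega>. Y i \<omega> - Y j \<omega>) (\<lambda>\<omega>. Y i \<omega> - Y j \<omega>) < e"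
  obtains Z where "square_integrable M Z"
    "(\<lambda>i. L2_inner M (\<lambda>\<omega>. Z \<omega> - Y i \<omega>) (\<lambda>\<omega>. Z \<omega> - Y i \<omega>)) \<longlonglongrightarrow> 0"
proof -
  let ?d = "\<lambda>f g. L2_inner M (\<lambda>\<omega>. f \<omega> - g \<omega>) (\<lambda>\<omega>. f \<omega> - g \<omega>)"
  have [measurable]: "Y i \<in> borel_measurable M" for i
    using Y by (simp add: square_integrable_def)
  have "\<exists>N. \<forall>i\<ge>N. \<forall>j\<ge>N. ?d (Y i) (Y j) < (1 / 4) ^ k" for k :: nat
    by (rule cauchy) simp
  then obtain N where N: "\<And>k i j. N k \<le> i \<Longrightarrow> N k \<le> j \<Longrightarrow> ?d (Y i) (Y j) < (1 / 4) ^ k"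
    by metis
  \<comment> \<open>a monotone choice of indices that dominates \<open>N\<close> and tends to infinity\<close>
  define r where "r = (\<lambda>k. \<Sum>i\<le>k. N i + 1)"
  have r: "N k \<le> r k" "r k \<le> r (Suc k)" "k \<le> r k" for k
  proof -
    have "N k + 1 \<le> r k" unfolding r_def by (rule member_le_sum) auto
    thus "N k \<le> r k" by simp
    show "r k \<le> r (Suc k)" by (simp add: r_def)
    show "k \<le> r k" by (induction k) (auto simp: r_def)
  qed
  define D where "D = (\<lambda>k \<omega>. Y (r (Suc k)) \<omega> - Y (r k) \<omega>)"
  have D: "square_integrable M (D k)" for k unfolding D_def by (intro L2_diff Y)
  have D_int: "integrable M (D k)" for k
    using L2_mult_integrable[OF D[of k], of "\<lambda>_. 1"] by (simp add: square_integrable_def)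
  have D_le: "(\<integral>\<omega>. \<bar>D k \<omega>\<bar> \<partial>M) \<le> (1 / 2) ^ k" for k
  proof -
    \<comment> \<open>on a probability space the \<open>L\<^sub>1\<close> norm is at most the \<open>L\<^sub>2\<close> norm\<close>
    have "(L2_inner M (\<lambda>\<omega>. \<bar>D k \<omega>\<bar>) (\<lambda>_. 1))\<^sup>2 \<le> L2_inner M (\<lambda>\<omega>. \<bar>D k \<omega>\<bar>) (\<lambda>\<omega>. \<bar>D k \<omega>\<bar>) * L2_inner M (\<lambda>_. 1) (\<lambda>_. 1)"
      using D[of k] by (intro Cauchy_Schwarz_L2) (auto simp: square_integrable_def)
    also have "\<dots> = ?d (Y (r (Suc k))) (Y (r k))"
      by (simp add: L2_inner_def D_def prob_space)
    also have "\<dots> \<le> (1 / 4) ^ k"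
      using N[of k "r (Suc k)" "r k"] r(1,2)[of k] by (intro less_imp_le) simp
    also have "\<dots> = ((1 / 2) ^ k)\<^sup>2"
      by (simp add: power2_eq_square flip: power_mult_distrib)
    finally have "(\<integral>\<omega>. \<bar>D k \<omega>\<bar> \<partial>M)\<^sup>2 \<le> ((1 / 2) ^ k)\<^sup>2" by (simp add: L2_inner_def)
    thus ?thesis by (rule power2_le_imp_le) simp
  qed
  have "(\<integral>\<^sup>+\<omega>. (\<Sum>k. ennreal \<bar>D k \<omega>\<bar>) \<partial>M) = (\<Sum>k. \<integral>\<^sup>+\<omega>. ennreal \<bar>D k \<omega>\<bar> \<partial>M)"
    by (intro nn_integral_suminf) (simp add: D_def)
  also have "\<dots> = (\<Sum>k. ennreal (\<integral>\<omega>. \<bar>D k \<omega>\<bar> \<partial>M))"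
    using D_int by (intro suminf_cong nn_integral_eq_integral) auto
  also have "\<dots> \<le> (\<Sum>k. ennreal ((1 / 2) ^ k))"
    by (intro suminf_le ennreal_leI D_le) auto
  also have "\<dots> = ennreal (\<Sum>k. (1 / 2) ^ k)"
    by (intro suminf_ennreal2 summable_geometric) auto
  also have "\<dots> < \<infinity>" by simp
  finally have "(\<integral>\<^sup>+\<omega>. (\<Sum>k. ennreal \<bar>D k \<omega>\<bar>) \<partial>M) \<noteq> \<infinity>" by simp
  hence "AE \<omega> in M. (\<Sum>k. ennreal \<bar>D k \<omega>\<bar>) \<noteq> \<infinity>"
    by (intro nn_integral_noteq_infinite) (auto simp: D_def)
  hence conv: "AE \<omega> in M. convergent (\<lambda>k. Y (r k) \<omega>)"
  proof eventually_elim
    case (elim \<omega>)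
    have "summable (\<lambda>k. \<bar>D k \<omega>\<bar>)"
      using elim by (intro summable_suminf_not_top) (auto simp: top_ennreal_def)
    hence "summable (\<lambda>k. D k \<omega>)" by (rule summable_rabs_cancel)
    hence "convergent (\<lambda>n. \<Sum>k<n. D k \<omega>)" by (simp add: summable_iff_convergent)
    moreover have "(\<Sum>k<n. D k \<omega>) = Y (r n) \<omega> - Y (r 0) \<omega>" for n
      unfolding D_def by (rule sum_lessThan_telescope)
    ultimately have "convergent (\<lambda>n. (Y (r n) \<omega> - Y (r 0) \<omega>) + Y (r 0) \<omega>)"
      by (intro convergent_add convergent_const) simp
    thus ?case by simp
  qed
  define Z where "Z = (\<lambda>\<omega>. lim (\<lambda>k. Y (r k) \<omega>))"
  have [measurable]: "Z \<in> borel_measurable M"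
    unfolding Z_def by (rule borel_measurable_lim_metric) simp
  have close: "integrable M (\<lambda>\<omega>. (Z \<omega> - Y i \<omega>)\<^sup>2) \<and> ?d Z (Y i) \<le> e"
    if e: "0 < e" and i: "\<And>i j. n \<le> i \<Longrightarrow> n \<le> j \<Longrightarrow> ?d (Y i) (Y j) < e" "n \<le> i" for e n i
  proof -
    have "(\<integral>\<^sup>+\<omega>. ennreal ((Z \<omega> - Y i \<omega>)\<^sup>2) \<partial>M)
          = (\<integral>\<^sup>+\<omega>. liminf (\<lambda>k. ennreal ((Y (r k) \<omega> - Y i \<omega>)\<^sup>2)) \<partial>M)"
    proof (rule nn_integral_cong_AE, use conv in eventually_elim)
      case (elim \<omega>)
      hence "(\<lambda>k. Y (r k) \<omega>) \<longlonglongrightarrow> Z \<omega>"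
        unfolding Z_def by (simp add: convergent_LIMSEQ_iff)
      hence "(\<lambda>k. ennreal ((Y (r k) \<omega> - Y i \<omega>)\<^sup>2)) \<longlonglongrightarrow> ennreal ((Z \<omega> - Y i \<omega>)\<^sup>2)"
        by (intro tendsto_ennrealI tendsto_intros)
      from lim_imp_Liminf[OF _ this] show ?case by simp
    qed
    also have "\<dots> \<le> liminf (\<lambda>k. \<integral>\<^sup>+\<omega>. ennreal ((Y (r k) \<omega> - Y i \<omega>)\<^sup>2) \<partial>M)"
      by (rule nn_integral_liminf) simp
    also have "\<dots> \<le> liminf (\<lambda>k::nat. ennreal e)"
    proof (rule Liminf_mono, rule eventually_sequentiallyI)
      fix k assume "n \<le> k"
      hence "n \<le> r k" using r(3)[of k] by simp
      have "square_integrable M (\<lambda>\<omega>. Y (r k) \<omega> - Y i \<omega>)" by (intro L2_diff Y)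
      hence "(\<integral>\<^sup>+\<omega>. ennreal ((Y (r k) \<omega> - Y i \<omega>)\<^sup>2) \<partial>M) = ennreal (?d (Y (r k)) (Y i))"
        by (subst nn_integral_eq_integral) (auto simp: square_integrable_def L2_inner_def power2_eq_square)
      also have "\<dots> \<le> ennreal e"
        using i(1)[OF \<open>n \<le> r k\<close> i(2)] by (intro ennreal_leI) simp
      finally show "(\<integral>\<^sup>+\<omega>. ennreal ((Y (r k) \<omega> - Y i \<omega>)\<^sup>2) \<partial>M) \<le> ennreal e" .
    qed
    also have "\<dots> = ennreal e" by (simp add: Liminf_const)
    finally have le: "(\<integral>\<^sup>+\<omega>. ennreal ((Z \<omega> - Y i \<omega>)\<^sup>2) \<partial>M) \<le> ennreal e" .
    have int: "integrable M (\<lambda>\<omega>. (Z \<omega> - Y i \<omega>)\<^sup>2)"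
      using le by (intro integrableI_bounded) (auto intro: le_less_trans)
    moreover have "(\<integral>\<omega>. (Z \<omega> - Y i \<omega>)\<^sup>2 \<partial>M) \<le> e"
      using le e nn_integral_eq_integral[OF int] by simp
    ultimately show ?thesis by (simp add: L2_inner_def power2_eq_square)
  qed
  have lim: "(\<lambda>i. ?d Z (Y i)) \<longlonglongrightarrow> 0"
  proof (rule LIMSEQ_I)
    fix e :: real assume "0 < e"
    then obtain n where "\<forall>i\<ge>n. \<forall>j\<ge>n. ?d (Y i) (Y j) < e / 2" using cauchy[of "e / 2"] by auto
    hence "?d Z (Y i) \<le> e / 2" if "n \<le> i" for i
      using close[of "e / 2" n i] that \<open>0 < e\<close> by auto
    hence "norm (?d Z (Y i) - 0) < e" if "n \<le> i" for i
      using that \<open>0 < e\<close> L2_inner_self_nonneg[of M "\<lambda>\<omega>. Z \<omega> - Y i \<omega>"] by fastforce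
    thus "\<exists>n. \<forall>i\<ge>n. norm (?d Z (Y i) - 0) < e" by blast
  qed
  have "square_integrable M Z"
  proof -
    obtain n where "\<forall>i\<ge>n. \<forall>j\<ge>n. ?d (Y i) (Y j) < 1" using cauchy[of 1] by auto
    hence "integrable M (\<lambda>\<omega>. (Z \<omega> - Y n \<omega>)\<^sup>2)" using close[of 1 n n] by auto
    hence "square_integrable M (\<lambda>\<omega>. Z \<omega> - Y n \<omega>)" by (simp add: square_integrable_def)
    from L2_add[OF this Y[of n]] show ?thesis by simp
  qed
  thus ?thesis using that lim by blast
qed

lemma rv_spanE:
  assumes "Z \<in> rv_span X I"
  obtains F c where "finite F" "F \<subseteq> I" "Z = (\<lambda>\<omega>. \<Sum>i\<in>F. c i * X i \<omega>)"
  using assms unfolding rv_span_def by blast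

lemma rv_span_lincomb: "finite F \<Longrightarrow> F \<subseteq> I \<Longrightarrow> (\<lambda>\<omega>. \<Sum>i\<in>F. c i * X i \<omega>) \<in> rv_span X I"
  unfolding rv_span_def by blast

text \<open>The projections \<open>P\<^sub>p\<close> on the spans of the variables with index in \<open>I \<inter> {-p..p}\<close> have decreasing
squared residual norms, and by Pythagoras the squared distance of two projections is the difference of
these. So they form a Cauchy sequence, and its limit is the projection.\<close>

lemma (in prob_space) closed_span_projection_exists:
  assumes X: "\<And>i. square_integrable M (X i)" and Y: "square_integrable M Y"
  shows "\<exists>P. is_orth_proj M (closed_rv_span M X I) Y P"
proof -
  define F where "F = (\<lambda>p. I \<inter> {- int p..int p})"
  have F: "finite (F p)" "F p \<subseteq> I" for p by (auto simp: F_def)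
  have F_mono: "F p \<subseteq> F q" if "p \<le> q" for p q using that by (auto simp: F_def)
  have "\<exists>c. \<forall>j\<in>F p. L2_inner M (\<lambda>\<omega>. Y \<omega> - (\<Sum>i\<in>F p. c i * X i \<omega>)) (X j) = 0" for p
    by (rule finite_projection[OF F(1) X Y])
  then obtain c where c: "\<And>p j. j \<in> F p \<Longrightarrow> L2_inner M (\<lambda>\<omega>. Y \<omega> - (\<Sum>i\<in>F p. c p i * X i \<omega>)) (X j) = 0"
    by metis
  define P where "P = (\<lambda>p \<omega>. \<Sum>i\<in>F p. c p i * X i \<omega>)"
  define e where "e = (\<lambda>p \<omega>. Y \<omega> - P p \<omega>)"
  have P: "square_integrable M (P p)" for p unfolding P_def by (rule L2_lincomb[OF X])
  have e: "square_integrable M (e p)" for p unfolding e_def by (rule L2_diff[OF Y P])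
  have eX: "L2_inner M (e p) (X j) = 0" if "j \<in> F p" for p j
    using c[OF that] by (simp add: e_def P_def)
  have e_lincomb: "L2_inner M (e p) (\<lambda>\<omega>. \<Sum>i\<in>G. d i * X i \<omega>) = 0" if "G \<subseteq> F p" for p G d
    using L2_inner_lincomb_right[of G M X "e p" d] X e eX that by (simp add: subset_iff)
  let ?d = "\<lambda>f g. L2_inner M (\<lambda>\<omega>. f \<omega> - g \<omega>) (\<lambda>\<omega>. f \<omega> - g \<omega>)"
  have pyth: "L2_inner M (e p) (e p) = L2_inner M (e q) (e q) + ?d (P q) (P p)" if "p \<le> q" for p q
  proof -
    let ?h = "\<lambda>\<omega>. P q \<omega> - P p \<omega>"
    have h: "square_integrable M ?h" by (rule L2_diff[OF P P])
    have "L2_inner M (e q) ?h = L2_inner M (e q) (P q) - L2_inner M (e q) (P p)"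
      by (rule L2_inner_diff_right[OF P P e])
    also have "\<dots> = 0"
      using e_lincomb[of "F q" q "c q"] e_lincomb[of "F p" q "c p"] F_mono[OF that] by (simp add: P_def)
    finally have 0: "L2_inner M (e q) ?h = 0" "L2_inner M ?h (e q) = 0" by (simp_all add: L2_inner_commute)
    have ep: "e p = (\<lambda>\<omega>. ?h \<omega> + e q \<omega>)" by (simp add: e_def)
    have "L2_inner M (e p) (e p) = L2_inner M (e p) ?h + L2_inner M (e p) (e q)"
      by (subst (2) ep) (rule L2_inner_add_right[OF h e e])
    also have "L2_inner M (e p) ?h = L2_inner M ?h ?h"
      using L2_inner_add_left[OF h e h, of q] 0 by (simp add: ep)
    also have "L2_inner M (e p) (e q) = L2_inner M (e q) (e q)"
      using L2_inner_add_left[OF h e e, of q q] 0 by (simp add: ep)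
    finally show ?thesis by simp
  qed
  have "decseq (\<lambda>p. L2_inner M (e p) (e p))"
    unfolding decseq_def using pyth by fastforce
  hence C: "Cauchy (\<lambda>p. L2_inner M (e p) (e p))"
    by (rule decseq_convergent[where B = 0]) (auto simp: LIMSEQ_imp_Cauchy)
  have cauchy: "\<exists>N. \<forall>i\<ge>N. \<forall>j\<ge>N. ?d (P i) (P j) < \<epsilon>" if "0 < \<epsilon>" for \<epsilon>
  proof -
    obtain N where N: "\<And>i j. N \<le> i \<Longrightarrow> N \<le> j \<Longrightarrow> \<bar>L2_inner M (e i) (e i) - L2_inner M (e j) (e j)\<bar> < \<epsilon>"
      using C \<open>0 < \<epsilon>\<close> unfolding Cauchy_def dist_real_def by blast
    have "?d (P i) (P j) < \<epsilon>" if "N \<le> i" "N \<le> j" for i j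
    proof (cases "j \<le> i")
      case True
      thus ?thesis using pyth[OF True] N[OF that] by linarith
    next
      case False
      have "?d (P i) (P j) = ?d (P j) (P i)"
        unfolding L2_inner_def by (rule Bochner_Integration.integral_cong) (auto simp: algebra_simps)
      thus ?thesis using pyth[of i j] N[OF that] False by linarith
    qed
    thus ?thesis by blast
  qed
  obtain Q where Q: "square_integrable M Q" and lim: "(\<lambda>p. ?d Q (P p)) \<longlonglongrightarrow> 0"
    using L2_complete[of P, OF P cauchy] by blast
  have Q_in: "Q \<in> closed_rv_span M X I"
    unfolding closed_rv_span_def
  proof (intro CollectI conjI Q allI impI)
    fix \<epsilon> :: real assume "0 < \<epsilon>"
    hence "\<forall>\<^sub>F p in sequentially. ?d Q (P p) < \<epsilon>\<^sup>2" by (intro order_tendstoD[OF lim]) simp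
    then obtain p where "?d Q (P p) < \<epsilon>\<^sup>2" by (auto simp: eventually_sequentially)
    hence "sqrt (\<integral>\<omega>. (Q \<omega> - P p \<omega>)\<^sup>2 \<partial>M) < sqrt (\<epsilon>\<^sup>2)"
      by (intro real_sqrt_less_mono) (simp add: L2_inner_def power2_eq_square)
    thus "\<exists>Z\<in>rv_span X I. sqrt (\<integral>\<omega>. (Q \<omega> - Z \<omega>)\<^sup>2 \<partial>M) < \<epsilon>"
      using \<open>0 < \<epsilon>\<close> rv_span_lincomb[OF F(1)[of p] F(2)[of p], where c = "c p" and X = X]
      by (intro bexI[of _ "P p"]) (auto simp: P_def)
  qed
  define E where "E = (\<lambda>\<omega>. Y \<omega> - Q \<omega>)"
  have E: "square_integrable M E" unfolding E_def by (rule L2_diff[OF Y Q])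
  have E_lim: "(\<lambda>p. ?d E (e p)) \<longlonglongrightarrow> 0"
  proof -
    have "?d E (e p) = ?d Q (P p)" for p
      unfolding L2_inner_def by (rule Bochner_Integration.integral_cong) (auto simp: algebra_simps E_def e_def)
    thus ?thesis using lim by simp
  qed
  have E_span: "L2_inner M E Z = 0" if Z: "Z \<in> rv_span X I" for Z
  proof -
    obtain G d where G: "finite G" "G \<subseteq> I" and Z_eq: "Z = (\<lambda>\<omega>. \<Sum>i\<in>G. d i * X i \<omega>)"
      using Z unfolding rv_span_def by blast
    define p0 where "p0 = nat (Max (insert 0 (abs ` G)))"
    have "G \<subseteq> F p" if "p0 \<le> p" for p
    proof
      fix i assume "i \<in> G"
      hence "\<bar>i\<bar> \<le> Max (insert 0 (abs ` G))" using G(1) by (intro Max_ge) auto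
      hence "\<bar>i\<bar> \<le> int p" using that unfolding p0_def by linarith
      thus "i \<in> F p" using \<open>i \<in> G\<close> G(2) by (auto simp: F_def)
    qed
    hence "\<forall>\<^sub>F p in sequentially. L2_inner M (e p) Z = 0"
      unfolding Z_eq using e_lincomb by (intro eventually_sequentiallyI[of p0]) blast
    hence "(\<lambda>p. L2_inner M (e p) Z) \<longlonglongrightarrow> 0" by (rule tendsto_eventually)
    moreover have "(\<lambda>p. L2_inner M (e p) Z) \<longlonglongrightarrow> L2_inner M E Z"
      using E_lim unfolding Z_eq by (intro L2_inner_tendsto e E L2_lincomb X)
    ultimately show ?thesis using LIMSEQ_unique by blast
  qed
  have "L2_inner M E Z = 0" if Z: "Z \<in> closed_rv_span M X I" for Z
  proof -
    have ZL: "square_integrable M Z" using Z by (simp add: closed_rv_span_def)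
    have "\<exists>W. W \<in> rv_span X I \<and> sqrt (\<integral>\<omega>. (Z \<omega> - W \<omega>)\<^sup>2 \<partial>M) < 1 / real (Suc k)" for k
    proof -
      have "0 < 1 / real (Suc k)" by simp
      thus ?thesis using Z unfolding closed_rv_span_def by blast
    qed
    then obtain W where W: "\<And>k. W k \<in> rv_span X I"
      "\<And>k. sqrt (\<integral>\<omega>. (Z \<omega> - W k \<omega>)\<^sup>2 \<partial>M) < 1 / real (Suc k)" by metis
    have WL: "square_integrable M (W k)" for k
      using W(1)[of k] unfolding rv_span_def by (auto intro!: L2_lincomb X)
    have "(\<lambda>k. sqrt (?d Z (W k))) \<longlonglongrightarrow> 0"
    proof (rule tendsto_sandwich[OF _ _ tendsto_const LIMSEQ_inverse_real_of_nat])
      show "\<forall>\<^sub>F k in sequentially. sqrt (?d Z (W k)) \<le> inverse (real (Suc k))"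
        using W(2) by (intro always_eventually allI less_imp_le) (simp add: L2_inner_def power2_eq_square inverse_eq_divide)
    qed simp
    hence "(\<lambda>k. (sqrt (?d Z (W k)))\<^sup>2) \<longlonglongrightarrow> 0\<^sup>2" by (rule tendsto_power)
    hence "(\<lambda>k. ?d Z (W k)) \<longlonglongrightarrow> 0" by simp
    hence "(\<lambda>k. L2_inner M (W k) E) \<longlonglongrightarrow> L2_inner M Z E" by (intro L2_inner_tendsto WL ZL E)
    moreover have "L2_inner M (W k) E = 0" for k using E_span[OF W(1)] by (simp add: L2_inner_commute)
    ultimately have "L2_inner M Z E = 0" by (simp add: LIMSEQ_const_iff)
    thus ?thesis by (simp add: L2_inner_commute)
  qed
  thus ?thesis using Q_in unfolding is_orth_proj_def E_def L2_inner_def by blast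
qed

text \<open>Uniqueness of projections up to null sets: the difference of the candidates is also the difference of
their residuals, and both residuals are orthogonal to it.\<close>

lemma AE_eq_of_orthogonal_differences:
  assumes "square_integrable M Y" "square_integrable M P" "square_integrable M P'"
    and "L2_inner M (\<lambda>\<omega>. Y \<omega> - P \<omega>) P = 0" "L2_inner M (\<lambda>\<omega>. Y \<omega> - P \<omega>) P' = 0"
    and "L2_inner M (\<lambda>\<omega>. Y \<omega> - P' \<omega>) P = 0" "L2_inner M (\<lambda>\<omega>. Y \<omega> - P' \<omega>) P' = 0"
  shows "AE \<omega> in M. P \<omega> = P' \<omega>"
proof -
  let ?h = "\<lambda>\<omega>. P \<omega> - P' \<omega>"
  have h: "square_integrable M ?h" by (rule L2_diff[OF assms(2,3)])
  have e: "square_integrable M (\<lambda>\<omega>. Y \<omega> - P \<omega>)" "square_integrable M (\<lambda>\<omega>. Y \<omega> - P' \<omega>)"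
    by (intro L2_diff assms)+
  have "L2_inner M ?h ?h = L2_inner M (\<lambda>\<omega>. (Y \<omega> - P' \<omega>) - (Y \<omega> - P \<omega>)) ?h" by simp
  also have "\<dots> = 0"
    using L2_inner_diff_left[OF e(2,1) h] L2_inner_diff_right[OF assms(2,3) e(1)] L2_inner_diff_right[OF assms(2,3) e(2)] assms(4-7)
    by simp
  finally show ?thesis using L2_inner_self_zero[OF h] by simp
qed

section \<open>Autocovariances of the process and of its predictors\<close>

lemma wss_L2: "zero_mean_wss M X \<Longrightarrow> square_integrable M (X n)"
  by (simp add: zero_mean_wss_def)

lemma wss_L2_inner:
  assumes "zero_mean_wss M X"
  shows "L2_inner M (X i) (X j) = autocov M X (i - j)"
proof -
  have "\<forall>k m n. (\<integral>\<omega>. X (n + k) \<omega> * X n \<omega> \<partial>M) = (\<integral>\<omega>. X (m + k) \<omega> * X m \<omega> \<partial>M)"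
    using assms by (simp add: zero_mean_wss_def)
  from this[rule_format, of j "i - j" 0] show ?thesis by (simp add: L2_inner_def autocov_def)
qed

lemma (in prob_space) predictor_is_orth_proj:
  assumes "\<And>n. square_integrable M (X n)"
  shows "is_orth_proj M (past M X (n - 1)) (X n) (predictor M X n)"
  unfolding predictor_def orth_proj_def past_def
  by (rule someI_ex[of "is_orth_proj M (closed_rv_span M X {..n - 1}) (X n)"])
     (rule closed_span_projection_exists[OF assms assms])

lemma (in prob_space) innovation_L2:
  assumes "\<And>n. square_integrable M (X n)"
  shows "square_integrable M (predictor M X n)" "square_integrable M (innovation M X n)"
proof -
  show *: "square_integrable M (predictor M X n)"
    using predictor_is_orth_proj[of X n, OF assms]
    by (simp add: is_orth_proj_def past_def closed_rv_span_def)
  show "square_integrable M (innovation M X n)"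
    unfolding innovation_def by (rule L2_diff[OF assms *])
qed

lemma wold_tendsto:
  assumes X: "\<And>n. square_integrable M (X n)" and nu: "\<And>n. square_integrable M (\<nu> n)"
    and wold: "wold_decomposition M X \<nu> a" and Z: "square_integrable M Z"
  shows "(\<lambda>N. \<Sum>k<N. a k * L2_inner M (\<nu> (n - int k)) Z) \<longlonglongrightarrow> L2_inner M (X n) Z"
proof -
  define S where "S = (\<lambda>N \<omega>. \<Sum>k<N. a k * \<nu> (n - int k) \<omega>)"
  have S: "square_integrable M (S N)" for N unfolding S_def by (rule L2_lincomb[OF nu])
  have "(\<lambda>N. sqrt (\<integral>\<omega>. (X n \<omega> - S N \<omega>)\<^sup>2 \<partial>M)) \<longlonglongrightarrow> 0"
    using wold unfolding wold_decomposition_def S_def by blast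
  hence "(\<lambda>N. (sqrt (\<integral>\<omega>. (X n \<omega> - S N \<omega>)\<^sup>2 \<partial>M))\<^sup>2) \<longlonglongrightarrow> 0\<^sup>2" by (rule tendsto_power)
  hence "(\<lambda>N. L2_inner M (\<lambda>\<omega>. X n \<omega> - S N \<omega>) (\<lambda>\<omega>. X n \<omega> - S N \<omega>)) \<longlonglongrightarrow> 0"
    by (simp add: L2_inner_def power2_eq_square)
  hence "(\<lambda>N. L2_inner M (S N) Z) \<longlonglongrightarrow> L2_inner M (X n) Z" by (intro L2_inner_tendsto S X Z)
  moreover have "L2_inner M (S N) Z = (\<Sum>k<N. a k * L2_inner M (\<nu> (n - int k)) Z)" for N
    unfolding S_def by (rule L2_inner_lincomb_left[OF nu Z])
  ultimately show ?thesis by simp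
qed

lemma wold_inner_innovation:
  assumes X: "\<And>n. square_integrable M (X n)" and nu: "\<And>n. square_integrable M (\<nu> n)"
    and orth: "\<And>n k. L2_inner M (\<nu> n) (\<nu> k) = (if n = k then 1 else 0)"
    and wold: "wold_decomposition M X \<nu> a"
  shows "L2_inner M (X n) (\<nu> m) = causal a (n - m)"
proof -
  have "\<forall>\<^sub>F N in sequentially. (\<Sum>k<N. a k * L2_inner M (\<nu> (n - int k)) (\<nu> m)) = causal a (n - m)"
  proof (rule eventually_sequentiallyI)
    fix N assume N: "nat (n - m) + 1 \<le> N"
    have "(\<Sum>k<N. a k * L2_inner M (\<nu> (n - int k)) (\<nu> m)) = (\<Sum>k<N. if int k = n - m then a k else 0)"
      by (rule sum.cong) (auto simp: orth)
    also have "\<dots> = causal a (n - m)"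
    proof (cases "n - m < 0")
      case True
      have "(\<Sum>k<N. if int k = n - m then a k else 0) = (\<Sum>k<N. 0)"
        by (rule sum.cong) (use True in auto)
      thus ?thesis using True by simp
    next
      case False
      hence "int k = n - m \<longleftrightarrow> k = nat (n - m)" for k by auto
      thus ?thesis using N False by (simp add: causal_def)
    qed
    finally show "(\<Sum>k<N. a k * L2_inner M (\<nu> (n - int k)) (\<nu> m)) = causal a (n - m)" .
  qed
  from LIMSEQ_unique[OF tendsto_eventually[OF this] wold_tendsto[OF X nu wold nu]] show ?thesis ..
qed

text \<open>Expand one factor of \<open>\<bbbE>[X\<^sub>0 X\<^sub>k]\<close> in its Wold series and use \<open>\<bbbE>[X\<^sub>k \<nu>\<^sub>-\<^sub>j] = a\<^sub>k\<^sub>+\<^sub>j\<close>.\<close>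

lemma wold_autocov:
  assumes X: "\<And>n. square_integrable M (X n)" and nu: "\<And>n. square_integrable M (\<nu> n)"
    and orth: "\<And>n k. L2_inner M (\<nu> n) (\<nu> k) = (if n = k then 1 else 0)"
    and wold: "wold_decomposition M X \<nu> a" and a: "summable (\<lambda>k. \<bar>a k\<bar>)"
  shows "autocov M X = conv (causal a) (reflect (causal a))"
proof
  fix k :: int
  let ?g = "\<lambda>i. causal a i * causal a (k + i)"
  note ca = l1_causal[OF a]
  have g: "l1 ?g"
    using conv_summable[OF ca l1_reflect[OF ca], of "- k"] by (simp add: reflect_def add.commute)
  have inner_X: "a j * L2_inner M (\<nu> (0 - int j)) (X k) = ?g (int j)" for j
    using wold_inner_innovation[OF X nu orth wold, of k "0 - int j"] by (simp add: L2_inner_commute[of M _ "X k"])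
  have "(\<lambda>j. ?g (int j)) sums infsum ?g UNIV"
    by (rule sums_nonneg_support[OF g]) simp
  hence "(\<lambda>N. \<Sum>j<N. ?g (int j)) \<longlonglongrightarrow> infsum ?g UNIV" by (simp only: sums_def)
  moreover have "(\<lambda>N. \<Sum>j<N. ?g (int j)) \<longlonglongrightarrow> L2_inner M (X 0) (X k)"
    using wold_tendsto[OF X nu wold X, of 0 k] by (simp only: inner_X)
  ultimately have "L2_inner M (X 0) (X k) = infsum ?g UNIV" using LIMSEQ_unique by blast
  also have "\<dots> = conv (causal a) (reflect (causal a)) (- k)"
    by (simp add: conv_def reflect_def add.commute)
  also have "\<dots> = reflect (conv (causal a) (reflect (causal a))) k" by (simp add: reflect_def)
  also have "\<dots> = conv (causal a) (reflect (causal a)) k"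
  proof -
    have "reflect (reflect (causal a)) = causal a" by (simp add: reflect_def fun_eq_iff)
    thus ?thesis using reflect_conv[of "causal a" "reflect (causal a)"] by (simp add: conv_commute)
  qed
  finally show "autocov M X k = conv (causal a) (reflect (causal a)) k"
    by (simp add: autocov_def L2_inner_def mult.commute)
qed

text \<open>Choose a finite combination \<open>Z\<close> of \<open>X\<^sub>-\<^sub>1, X\<^sub>-\<^sub>2, \<dots>\<close> at distance less than \<open>\<epsilon>\<close> from the predictor of
\<open>X\<^sub>0\<close>. The difference equals \<open>X\<^sub>0 - Z - \<nu>\<^sub>0\<close>, and its coefficients \<open>r\<^sub>k\<close> with respect to the
innovations \<open>\<nu>\<^sub>-\<^sub>k\<close> are bounded by \<open>\<epsilon>\<close>. They are the coefficients of \<open>A q - 1\<close>, where the polynomial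
\<open>q\<close> collects the weights of \<open>X\<^sub>0 - Z\<close>. If \<open>A z = 0\<close>, the series of \<open>r\<^sub>k z\<^sup>k\<close> sums to \<open>-1\<close>, but its
modulus is at most \<open>\<epsilon> / (1 - \<bar>z\<bar>)\<close>.\<close>

lemma (in prob_space) wold_transfer_nonzero_in_disc:
  assumes X: "\<And>n. square_integrable M (X n)"
    and orth: "\<And>n k. L2_inner M (innovation M X n) (innovation M X k) = (if n = k then 1 else 0)"
    and wold: "wold_decomposition M X (innovation M X) a" and a: "summable (\<lambda>k. \<bar>a k\<bar>)"
    and z: "cmod z < 1"
  shows "(\<Sum>k. of_real (a k) * z ^ k) \<noteq> 0"
proof
  assume zero: "(\<Sum>k. of_real (a k) * z ^ k) = 0"
  let ?\<nu> = "innovation M X"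
  note nu = innovation_L2(2)[of X, OF X] and PL = innovation_L2(1)[of X, OF X]
  have sm: "summable (\<lambda>k. of_real (a k) * z ^ k)"
    by (rule summable_norm_cancel, rule summable_comparison_test'[OF a, of 0])
       (use z in \<open>auto simp: norm_mult norm_power intro!: mult_left_le power_le_one\<close>)
  have az: "(\<lambda>k. of_real (a k) * z ^ k) sums 0"
    using summable_sums[OF sm] zero by simp
  define \<epsilon> where "\<epsilon> = (1 - cmod z) / 2"
  have \<epsilon>: "0 < \<epsilon>" using z by (simp add: \<epsilon>_def)
  have "predictor M X 0 \<in> past M X (- 1)"
    using predictor_is_orth_proj[of X 0, OF X] by (simp add: is_orth_proj_def)
  then obtain Z where Z: "Z \<in> rv_span X {..- 1}"
    "sqrt (\<integral>\<omega>. (predictor M X 0 \<omega> - Z \<omega>)\<^sup>2 \<partial>M) < \<epsilon>"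
    using \<epsilon> unfolding past_def closed_rv_span_def by blast
  then obtain F c where F: "finite F" "F \<subseteq> {..- 1}" and Z_eq: "Z = (\<lambda>\<omega>. \<Sum>i\<in>F. c i * X i \<omega>)"
    unfolding rv_span_def by blast
  have ZL: "square_integrable M Z" unfolding Z_eq by (rule L2_lincomb[OF X])
  define D where "D = (\<lambda>\<omega>. predictor M X 0 \<omega> - Z \<omega>)"
  have D: "square_integrable M D" unfolding D_def by (rule L2_diff[OF PL ZL])
  have D_small: "sqrt (L2_inner M D D) < \<epsilon>"
    using Z(2) by (simp add: L2_inner_def D_def power2_eq_square)
  define r where "r = (\<lambda>k. L2_inner M D (?\<nu> (- int k)))"
  have r_le: "\<bar>r k\<bar> \<le> \<epsilon>" for k
  proof -
    have "(r k)\<^sup>2 \<le> L2_inner M D D * L2_inner M (?\<nu> (- int k)) (?\<nu> (- int k))"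
      unfolding r_def by (rule Cauchy_Schwarz_L2[OF D nu])
    hence "\<bar>r k\<bar> \<le> sqrt (L2_inner M D D)"
      by (simp add: orth real_le_rsqrt)
    thus ?thesis using D_small by simp
  qed
  have r_eq: "r k = a k - (\<Sum>i\<in>F. c i * causal a (i + int k)) - (if k = 0 then 1 else 0)" for k
  proof -
    have "D = (\<lambda>\<omega>. (X 0 \<omega> - Z \<omega>) - ?\<nu> 0 \<omega>)" by (simp add: D_def innovation_def fun_eq_iff)
    hence "r k = L2_inner M (X 0) (?\<nu> (- int k)) - L2_inner M Z (?\<nu> (- int k)) - L2_inner M (?\<nu> 0) (?\<nu> (- int k))"
      unfolding r_def using L2_inner_diff_left[OF L2_diff[OF X ZL] nu nu] L2_inner_diff_left[OF X ZL nu] by simp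
    also have "L2_inner M Z (?\<nu> (- int k)) = (\<Sum>i\<in>F. c i * causal a (i + int k))"
      unfolding Z_eq using L2_inner_lincomb_left[where f = X, OF X nu] wold_inner_innovation[OF X nu orth wold] by simp
    finally show ?thesis using wold_inner_innovation[OF X nu orth wold, of 0 "- int k"] by (simp add: orth)
  qed
  have shift: "(\<lambda>k. of_real (causal a (i + int k)) * z ^ k) sums 0" if "i \<in> F" for i
  proof -
    define n where "n = nat (- i)"
    have "i \<le> - 1" using F(2) \<open>i \<in> F\<close> by auto
    hence n: "i = - int n" by (simp add: n_def)
    have "(\<lambda>k. of_real (causal a (i + int (k + n))) * z ^ (k + n)) sums 0"
      using sums_mult[OF az, of "z ^ n"] by (simp add: n power_add mult_ac)
    thus ?thesis
      by (subst sums_zero_iff_shift[of n, symmetric]) (simp_all add: n)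
  qed
  have "(\<lambda>k. of_real (a k) * z ^ k - (\<Sum>i\<in>F. of_real (c i) * (of_real (causal a (i + int k)) * z ^ k))
         - (if k = 0 then 1 else 0)) sums (0 - (\<Sum>i\<in>F. of_real (c i) * 0) - 1)"
    by (intro sums_diff az sums_sum sums_mult shift) (use sums_single[of 0 "\<lambda>_. 1 :: complex"] in simp_all)
  also have "(\<lambda>k. of_real (a k) * z ^ k - (\<Sum>i\<in>F. of_real (c i) * (of_real (causal a (i + int k)) * z ^ k))
         - (if k = 0 then 1 else 0)) = (\<lambda>k. of_real (r k) * z ^ k)"
    by (auto simp: r_eq fun_eq_iff algebra_simps sum_distrib_left)
  finally have sums: "(\<lambda>k. of_real (r k) * z ^ k) sums - 1" by simp
  have geo: "(\<lambda>k. \<epsilon> * cmod z ^ k) sums (\<epsilon> * (1 / (1 - cmod z)))"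
    using z by (intro sums_mult geometric_sums) simp
  have "cmod (\<Sum>k. of_real (r k) * z ^ k) \<le> (\<Sum>k. \<epsilon> * cmod z ^ k)"
    using r_le by (intro norm_suminf_le sums_summable[OF geo])
      (auto simp: norm_mult norm_power intro!: mult_right_mono)
  hence "1 \<le> \<epsilon> * (1 / (1 - cmod z))"
    unfolding sums_unique[OF sums, symmetric] sums_unique[OF geo, symmetric] by simp
  thus False using z by (simp add: \<epsilon>_def)
qed

text \<open>The predictor is \<open>X\<^sub>n - \<nu>\<^sub>n\<close>, so removing the innovation removes the leading Wold coefficient.\<close>

lemma (in prob_space) predictor_autocov:
  assumes X: "\<And>n. square_integrable M (X n)"
    and orth: "\<And>n k. L2_inner M (innovation M X n) (innovation M X k) = (if n = k then 1 else 0)"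
    and wold: "wold_decomposition M X (innovation M X) a" and a: "summable (\<lambda>k. \<bar>a k\<bar>)"
  defines "g \<equiv> \<lambda>k. causal a k - delta k"
  shows "autocov M (predictor M X) = conv g (reflect g)"
proof
  fix k
  let ?\<nu> = "innovation M X"
  note nu = innovation_L2(2)[of X, OF X] and ca = l1_causal[OF a]
  have P: "predictor M X n = (\<lambda>\<omega>. X n \<omega> - ?\<nu> n \<omega>)" for n
    by (simp add: innovation_def)
  have "autocov M (predictor M X) k = L2_inner M (\<lambda>\<omega>. X k \<omega> - ?\<nu> k \<omega>) (\<lambda>\<omega>. X 0 \<omega> - ?\<nu> 0 \<omega>)"
    unfolding autocov_def L2_inner_def P ..
  also have "\<dots> = L2_inner M (X k) (X 0) - L2_inner M (X k) (?\<nu> 0) - (L2_inner M (?\<nu> k) (X 0) - L2_inner M (?\<nu> k) (?\<nu> 0))"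
    using X nu by (simp only: L2_inner_diff_left L2_inner_diff_right L2_diff)
  also have "\<dots> = conv (causal a) (reflect (causal a)) k - causal a k - (reflect (causal a) k - delta k)"
  proof -
    have "L2_inner M (X k) (X 0) = conv (causal a) (reflect (causal a)) k"
      using wold_autocov[OF X nu orth wold a] by (metis autocov_def L2_inner_def)
    moreover have "L2_inner M (?\<nu> k) (X 0) = reflect (causal a) k"
      using wold_inner_innovation[OF X nu orth wold, of 0 k] by (simp add: L2_inner_commute reflect_def)
    moreover have "L2_inner M (?\<nu> k) (?\<nu> 0) = delta k" by (simp add: orth delta_def)
    ultimately show ?thesis
      using wold_inner_innovation[OF X nu orth wold, of k 0] by simp
  qed
  also have "\<dots> = conv g (reflect g) k"
  proof -
    have rg: "reflect g = (\<lambda>k. reflect (causal a) k - delta k)"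
      by (simp add: g_def reflect_def fun_eq_iff delta_def)
    have lg: "l1 (reflect g)" unfolding g_def by (intro l1_reflect l1_diff ca l1_delta)
    have "conv (causal a) (reflect g) k = conv (causal a) (reflect (causal a)) k - causal a k"
      unfolding rg using conv_diff_left[OF l1_reflect[OF ca] l1_delta ca, of k]
      by (simp add: conv_commute[of "causal a"])
    thus ?thesis
      using conv_diff_left[OF ca l1_delta lg, of k] by (simp add: g_def[symmetric] rg)
  qed
  finally show "autocov M (predictor M X) k = conv g (reflect g) k" .
qed

text \<open>One coefficient sequence serves all times: coefficients that solve the normal equations at time 0
solve them at every time by stationarity, and uniqueness of projections identifies the result with
whichever version of the projection was chosen at that time.\<close>

lemma finite_predictor_coefficients:
  assumes wss: "zero_mean_wss M X" 
  obtains h :: "int \<Rightarrow> real" where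
    "\<And>k. k \<notin> {1..int p} \<Longrightarrow> h k = 0"
    "\<And>k. k \<in> {1..int p} \<Longrightarrow> conv h (autocov M X) k = autocov M X k"
    "\<And>n. AE \<omega> in M. finite_predictor M X p n \<omega> = (\<Sum>j\<in>{1..int p}. h j * X (n - j) \<omega>)"
    "\<And>n. square_integrable M (finite_predictor M X p n)"
proof -
  let ?J = "{1..int p}" and ?R = "autocov M X"
  note X = wss_L2[OF wss]
  obtain c where c: "\<forall>i\<in>?J. L2_inner M (\<lambda>\<omega>. X 0 \<omega> - (\<Sum>j\<in>?J. c j * X (- j) \<omega>)) (X (- i)) = 0"
    using finite_projection[of ?J M "\<lambda>j. X (- j)" "X 0", OF _ X X] by blast
  define h where "h = (\<lambda>k. if k \<in> ?J then c k else 0)"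
  define P where "P = (\<lambda>n \<omega>. \<Sum>j\<in>?J. h j * X (n - j) \<omega>)"
  have PL: "square_integrable M (P n)" for n unfolding P_def by (rule L2_lincomb[OF X])
  have h0: "h k = 0" if "k \<notin> ?J" for k using that by (auto simp: h_def)
  have residual_inner: "L2_inner M (\<lambda>\<omega>. X n \<omega> - P n \<omega>) (X (n - i)) = ?R i - conv h ?R i" for n i
  proof -
    have "L2_inner M (P n) (X (n - i)) = (\<Sum>j\<in>?J. h j * ?R (i - j))"
      unfolding P_def using L2_inner_lincomb_left[where f = "\<lambda>j. X (n - j)", OF X X] by (simp add: wss_L2_inner[OF wss])
    also have "\<dots> = conv h ?R i"
      by (rule conv_finite_support(1)[symmetric]) (use h0 in auto)
    finally show ?thesis using L2_inner_diff_left[OF X PL X] by (simp add: wss_L2_inner[OF wss])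
  qed
  have R: "conv h ?R i = ?R i" if "i \<in> ?J" for i
  proof -
    have "P 0 = (\<lambda>\<omega>. \<Sum>j\<in>?J. c j * X (- j) \<omega>)"
      unfolding P_def by (auto simp: h_def intro!: sum.cong)
    thus ?thesis using bspec[OF c that] residual_inner[of 0 i] by simp
  qed
  have FP: "(AE \<omega> in M. finite_predictor M X p n \<omega> = P n \<omega>) \<and>
    square_integrable M (finite_predictor M X p n)" for n
  proof -
    let ?H = "finite_past X p (n - 1)"
    have H: "?H = rv_span X {n - int p..n - 1}"
      by (simp add: finite_past_def)
    have P_in: "P n \<in> ?H"
    proof -
      have "P n = (\<lambda>\<omega>. \<Sum>i\<in>{n - int p..n - 1}. h (n - i) * X i \<omega>)"
        unfolding P_def
        by (intro ext sum.reindex_bij_witness[of _ "\<lambda>i. n - i" "\<lambda>j. n - j"]) auto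
      thus ?thesis unfolding H using rv_span_lincomb[where c = "\<lambda>i. h (n - i)"
          and F = "{n - int p..n - 1}" and I = "{n - int p..n - 1}" and X = X] by simp
    qed
    have P_orth: "L2_inner M (\<lambda>\<omega>. X n \<omega> - P n \<omega>) Z = 0" if Z: "Z \<in> ?H" for Z
    proof -
      obtain G d where G: "finite G" "G \<subseteq> {n - int p..n - 1}" "Z = (\<lambda>\<omega>. \<Sum>i\<in>G. d i * X i \<omega>)"
        using Z unfolding H by (rule rv_spanE)
      have "L2_inner M (\<lambda>\<omega>. X n \<omega> - P n \<omega>) (X i) = 0" if "i \<in> G" for i
      proof -
        have "n - i \<in> ?J" using G(2) that by auto
        from residual_inner[of n "n - i"] R[OF this] show ?thesis by simp
      qed
      moreover have "L2_inner M (\<lambda>\<omega>. X n \<omega> - P n \<omega>) (\<lambda>\<omega>. \<Sum>i\<in>G. d i * X i \<omega>)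
          = (\<Sum>i\<in>G. d i * L2_inner M (\<lambda>\<omega>. X n \<omega> - P n \<omega>) (X i))"
        by (rule L2_inner_lincomb_right[OF X L2_diff[OF X PL]])
      ultimately show ?thesis unfolding G(3) by simp
    qed
    have "is_orth_proj M ?H (X n) (P n)"
      using P_in P_orth by (simp add: is_orth_proj_def L2_inner_def)
    hence "is_orth_proj M ?H (X n) (finite_predictor M X p n)"
      unfolding finite_predictor_def orth_proj_def by (rule someI[of "is_orth_proj M ?H (X n)"])
    hence Q: "finite_predictor M X p n \<in> ?H"
      "\<And>Z. Z \<in> ?H \<Longrightarrow> L2_inner M (\<lambda>\<omega>. X n \<omega> - finite_predictor M X p n \<omega>) Z = 0"
      by (auto simp: is_orth_proj_def L2_inner_def)
    have QL: "square_integrable M (finite_predictor M X p n)"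
      using Q(1) unfolding H rv_span_def by (auto intro!: L2_lincomb X)
    have "AE \<omega> in M. finite_predictor M X p n \<omega> = P n \<omega>"
      by (rule AE_eq_of_orthogonal_differences[OF X[of n] QL PL]) (intro Q P_orth P_in)+
    thus ?thesis using QL by simp
  qed
  show ?thesis
    by (rule that[of h, OF h0 R]) (use FP in \<open>auto simp: P_def\<close>)
qed

lemma finite_predictor_autocov:
  assumes wss: "zero_mean_wss M X"
    and h0: "\<And>k. k \<notin> {1..int p} \<Longrightarrow> h k = 0"
    and AE: "\<And>n. AE \<omega> in M. finite_predictor M X p n \<omega> = (\<Sum>j\<in>{1..int p}. h j * X (n - j) \<omega>)"
    and meas: "\<And>n. square_integrable M (finite_predictor M X p n)"
  shows "autocov M (finite_predictor M X p) = conv h (conv (reflect h) (autocov M X))"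
proof
  fix k
  let ?J = "{1..int p}"
  let ?P = "\<lambda>n \<omega>. \<Sum>j\<in>?J. h j * X (n - j) \<omega>"
  note X = wss_L2[OF wss]
  have PL: "square_integrable M (?P n)" for n by (rule L2_lincomb[OF X])
  have "autocov M (finite_predictor M X p) k = L2_inner M (?P k) (?P 0)"
    unfolding autocov_def L2_inner_def[symmetric] by (rule L2_inner_cong_AE[OF meas PL meas PL AE AE])
  also have "\<dots> = (\<Sum>i\<in>?J. h i * (\<Sum>j\<in>?J. h j * L2_inner M (X (k - i)) (X (0 - j))))"
    by (simp only: L2_inner_lincomb_left[OF X PL] L2_inner_lincomb_right[OF X X])
  also have "\<dots> = (\<Sum>i\<in>?J. h i * (\<Sum>j\<in>?J. h j * autocov M X (k - i + j)))"
    by (simp add: wss_L2_inner[OF wss])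
  also have "\<dots> = conv h (conv (reflect h) (autocov M X)) k"
    by (simp only: conv_finite_support[OF finite_atLeastAtMost_int h0])
  finally show "autocov M (finite_predictor M X p) k = conv h (conv (reflect h) (autocov M X)) k" .
qed

section \<open>Convergence of the spectral densities\<close>

lemma spectral_density_eq_dtft: "spectral_density M Y l = dtft (autocov M Y) l"
  by (simp add: spectral_density_def dtft_def)

text \<open>Stability of the squared modulus: it turns distances of transfer functions into distances of
spectral densities.\<close>

lemma abs_cmod_square_diff_le:
  assumes "cmod (y - y0) \<le> x" "cmod y0 \<le> c"
  shows "\<bar>(cmod y)\<^sup>2 - (cmod y0)\<^sup>2\<bar> \<le> x * (x + 2 * c)"
proof -
  have "\<bar>cmod y - cmod y0\<bar> \<le> x" using norm_triangle_ineq3[of y y0] assms(1) by linarith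
  moreover have "cmod y + cmod y0 \<le> x + 2 * c" using norm_triangle_sub[of y y0] assms by linarith
  moreover have "\<bar>(cmod y)\<^sup>2 - (cmod y0)\<^sup>2\<bar> = \<bar>cmod y - cmod y0\<bar> * (cmod y + cmod y0)"
    by (simp add: power2_eq_square square_diff_square_factored abs_mult mult.commute)
  ultimately show ?thesis by (simp add: mult_mono)
qed

lemma sqrt_integral_square_le:
  fixes f :: "real \<Rightarrow> complex"
  assumes "0 \<le> B" "\<And>l. cmod (f l) \<le> B"
  shows "sqrt (LBINT l:{-1/2..1/2}. (cmod (f l))\<^sup>2) \<le> B"
proof -
  have "(LBINT l:{-1/2..1/2}. (cmod (f l))\<^sup>2) \<le> (LBINT l:{-1/2..1/2::real}. B\<^sup>2)"
    unfolding set_lebesgue_integral_def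
  proof (rule integral_mono')
    show "integrable lborel (\<lambda>l. indicator {-1/2..1/2::real} l *\<^sub>R B\<^sup>2)"
      by (intro integrable_scaleR_left integrable_real_indicator) auto
  qed (auto intro!: mult_left_mono power_mono assms simp: indicator_def)
  also have "\<dots> = B\<^sup>2" by (simp add: set_lebesgue_integral_def)
  finally have "sqrt (LBINT l:{-1/2..1/2}. (cmod (f l))\<^sup>2) \<le> sqrt (B\<^sup>2)" by (rule real_sqrt_le_mono)
  thus ?thesis using assms(1) by simp
qed

text \<open>Absorption: once \<open>t p < 1 / 2\<close>, the term \<open>t p * x p\<close> on the right is absorbed by half of the left
side, which leaves \<open>x p \<le> 2 * t p\<close>.\<close>

lemma bound_tendsto_0:
  fixes x t :: "nat \<Rightarrow> real"
  assumes x: "\<And>p. 0 \<le> x p" and t: "t \<longlonglongrightarrow> 0" and le: "\<And>p. x p \<le> t p * (1 + x p)"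
  shows "x \<longlonglongrightarrow> 0"
proof (rule tendsto_sandwich[OF _ _ tendsto_const])
  have "(\<lambda>p. 2 * t p) \<longlonglongrightarrow> 2 * 0" by (intro tendsto_intros t)
  thus "(\<lambda>p. 2 * t p) \<longlonglongrightarrow> 0" by simp
  have "\<forall>\<^sub>F p in sequentially. t p < 1 / 2" by (rule order_tendstoD[OF t]) simp
  thus "\<forall>\<^sub>F p in sequentially. x p \<le> 2 * t p"
  proof eventually_elim
    case (elim p)
    have "t p * x p \<le> 1 / 2 * x p" using elim x[of p] by (intro mult_right_mono) auto
    thus ?case using le[of p] by (simp add: distrib_left)
  qed
qed (use x in simp)

theorem proposition4p2:
  fixes M :: "'a measure" and X \<nu> :: "int \<Rightarrow> 'a \<Rightarrow> real" and a :: "nat \<Rightarrow> real"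
  assumes "prob_space M"
    and "zero_mean_wss M X"
    and "regular_process M X"
    and "\<nu> = innovation M X"
    and "\<And>n k. (\<integral>\<omega>. \<nu> n \<omega> * \<nu> k \<omega> \<partial>M) = (if n = k then 1 else 0)"
    and "wold_decomposition M X \<nu> a"
    and "\<And>l. l \<in> {-1/2<..1/2} \<Longrightarrow>
           spectral_density M X l \<in> \<real> \<and> 0 < Re (spectral_density M X l)"
    and "summable (\<lambda>k. \<bar>a k\<bar>)"
  shows "(\<lambda>p. sqrt (LBINT l:{-1/2..1/2}.
            (cmod (spectral_density M (finite_predictor M X p) l
                   - spectral_density M (predictor M X) l))\<^sup>2)) \<longlonglongrightarrow> 0"
proof -
  interpret prob_space M by fact
  note X = wss_L2[OF assms(2)]
  note nu = innovation_L2(2)[of X, OF X]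
  have orth: "L2_inner M (innovation M X n) (innovation M X k) = (if n = k then 1 else 0)" for n k
    using assms(5) by (simp add: L2_inner_def assms(4))
  have wold: "wold_decomposition M X (innovation M X) a" using assms(6) by (simp add: assms(4))
  have a0: "a 0 = 1" using wold by (simp add: wold_decomposition_def)
  note a = assms(8)
  define A where "A = causal a"
  have A: "l1 A" unfolding A_def by (rule l1_causal[OF a])
  note rA = l1_reflect[OF A]
  have R: "autocov M X = conv A (reflect A)"
    unfolding A_def by (rule wold_autocov[OF X nu orth wold a])
  have lR: "l1 (autocov M X)" unfolding R by (rule l1_conv[OF A rA])
  have SX: "spectral_density M X l = of_real ((cmod (dtft A l))\<^sup>2)" for l
    unfolding spectral_density_eq_dtft R by (rule dtft_conv_reflect[OF A])

  have circle: "dtft A l \<noteq> 0" if "l \<in> {-1/2<..1/2}" for l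
    using assms(7)[OF that] unfolding SX by auto
  have nonzero: "(\<Sum>k. of_real (a k) * z ^ k) \<noteq> 0" if "cmod z \<le> 1" for z
  proof (cases "cmod z < 1")
    case True
    thus ?thesis using wold_transfer_nonzero_in_disc[OF X orth wold a] by blast
  next
    case False
    thus ?thesis using transfer_nonzero_on_circle[OF a] circle that unfolding A_def by force
  qed
  obtain b where b: "summable (\<lambda>k. \<bar>b k\<bar>)"
    and ab: "\<And>n. (\<Sum>i\<le>n. a i * b (n - i)) = (if n = 0 then 1 else 0)"
    using wiener_power_series[OF a nonzero] by blast
  define B where "B = causal b"
  have B: "l1 B" unfolding B_def by (rule l1_causal[OF b])
  have AB: "conv A B = delta" unfolding A_def B_def by (rule conv_causal_delta[OF ab])

  have "\<exists>h. (\<forall>k. k \<notin> {1..int p} \<longrightarrow> h k = 0) \<and>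
      (\<forall>k. k \<in> {1..int p} \<longrightarrow> conv h (autocov M X) k = autocov M X k) \<and>
      autocov M (finite_predictor M X p) = conv h (conv (reflect h) (autocov M X))" for p
  proof (rule finite_predictor_coefficients[OF assms(2), of p])
    fix g :: "int \<Rightarrow> real"
    assume g: "\<And>k. k \<notin> {1..int p} \<Longrightarrow> g k = 0"
      "\<And>k. k \<in> {1..int p} \<Longrightarrow> conv g (autocov M X) k = autocov M X k"
      "\<And>n. AE \<omega> in M. finite_predictor M X p n \<omega> = (\<Sum>j\<in>{1..int p}. g j * X (n - j) \<omega>)"
      "\<And>n. square_integrable M (finite_predictor M X p n)"
    show ?thesis
      using g(1,2) finite_predictor_autocov[OF assms(2) g(1,3,4)] by (intro exI[of _ g]) blast
  qed
  then obtain h :: "nat \<Rightarrow> int \<Rightarrow> real" where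
    h0: "\<And>p k. k \<notin> {1..int p} \<Longrightarrow> h p k = 0" and
    hR: "\<And>p k. k \<in> {1..int p} \<Longrightarrow> conv (h p) (autocov M X) k = autocov M X k" and
    hP: "\<And>p. autocov M (finite_predictor M X p) = conv (h p) (conv (reflect (h p)) (autocov M X))"
    by metis
  have h: "l1 (h p)" for p
    by (rule l1_finite_support, rule finite_subset[of _ "{1..int p}"]) (use h0 in blast)+
  \<comment> \<open>the prediction error filter, whose support \<open>{0..p}\<close> is what Baxter's inequality exploits\<close>
  define u where "u = (\<lambda>p k. delta k - h p k)"
  have u: "l1 (u p)" for p unfolding u_def by (intro l1_diff l1_delta h)
  define x where "x = (\<lambda>p. l1_norm (\<lambda>k. conv A (u p) k - delta k))"
  have baxter: "x p \<le> l1_norm B * (l1_norm A)\<^sup>2 * l1_norm (tail_above p B) * (1 + x p)" for p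
    unfolding x_def
  proof (rule baxter_inequality[OF A B u AB])
    show "A k = 0" if "k < 0" for k using that by (simp add: A_def)
    show "B k = 0" if "k < 0" for k using that by (simp add: B_def)
    show "u p k = 0" if "k < 0 \<or> int p < k" for k
      using that h0[of k p] by (auto simp: u_def delta_def)
    show "A 0 * u p 0 = 1" using h0[of 0 p] by (simp add: A_def a0 u_def delta_def)
    show "conv (conv A (reflect A)) (u p) j = 0" if "1 \<le> j" "j \<le> int p" for j
      using hR[of j p] that conv_diff_left[OF l1_delta h lR, of p j]
      unfolding R[symmetric] by (simp add: u_def conv_commute[of "autocov M X"])
  qed
  have x_lim: "x \<longlonglongrightarrow> 0"
  proof (rule bound_tendsto_0[OF _ _ baxter])
    show "0 \<le> x p" for p by (simp add: x_def)
    show "(\<lambda>p. l1_norm B * (l1_norm A)\<^sup>2 * l1_norm (tail_above p B)) \<longlonglongrightarrow> 0"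
      by (intro tendsto_mult_right_zero l1_norm_tail_tendsto_0[OF B])
  qed

  define c where "c = l1_norm A + 1"
  have diff: "cmod (spectral_density M (finite_predictor M X p) l - spectral_density M (predictor M X) l)
      \<le> x p * (x p + 2 * c)" for p l
  proof -
    have S1: "spectral_density M (finite_predictor M X p) l = of_real ((cmod (dtft (h p) l * dtft A l))\<^sup>2)"
      unfolding spectral_density_eq_dtft hP R
        dtft_conv[OF h l1_conv[OF l1_reflect[OF h] l1_conv[OF A rA]]]
        dtft_conv[OF l1_reflect[OF h] l1_conv[OF A rA]] dtft_conv[OF A rA]
      by (simp add: dtft_reflect complex_norm_square mult_ac del: of_real_power)
    have S2: "spectral_density M (predictor M X) l = of_real ((cmod (dtft A l - 1))\<^sup>2)"
      unfolding spectral_density_eq_dtft predictor_autocov[OF X orth wold a]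
      using dtft_conv_reflect[OF l1_diff[OF A l1_delta], of l] dtft_diff[OF A l1_delta, of l]
      by (simp add: A_def)
    have "dtft (\<lambda>k. conv A (u p) k - delta k) l = dtft A l * (1 - dtft (h p) l) - 1"
      unfolding dtft_diff[OF l1_conv[OF A u] l1_delta] dtft_conv[OF A u]
      unfolding u_def dtft_diff[OF l1_delta h] by simp
    also have "\<dots> = - (dtft (h p) l * dtft A l - (dtft A l - 1))" by (simp add: algebra_simps)
    finally have "cmod (dtft (h p) l * dtft A l - (dtft A l - 1)) \<le> x p"
      using norm_dtft_le[OF l1_diff[OF l1_conv[OF A u] l1_delta], of p l]
      by (simp add: x_def norm_minus_commute)
    moreover have "cmod (dtft A l - 1) \<le> c"
      using norm_triangle_ineq4[of "dtft A l" 1] norm_dtft_le[OF A, of l] by (simp add: c_def)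
    ultimately show ?thesis
      using abs_cmod_square_diff_le unfolding S1 S2 of_real_diff[symmetric] norm_of_real by blast
  qed
  have "0 \<le> c" "\<And>p. 0 \<le> x p" by (simp_all add: c_def x_def)
  show ?thesis
  proof (rule tendsto_sandwich[OF _ _ tendsto_const])
    have "(\<lambda>p. x p * (x p + 2 * c)) \<longlonglongrightarrow> 0 * (0 + 2 * c)"
      by (intro tendsto_intros x_lim)
    thus "(\<lambda>p. x p * (x p + 2 * c)) \<longlonglongrightarrow> 0" by simp
    show "\<forall>\<^sub>F p in sequentially. sqrt (LBINT l:{-1/2..1/2}.
        (cmod (spectral_density M (finite_predictor M X p) l - spectral_density M (predictor M X) l))\<^sup>2)
        \<le> x p * (x p + 2 * c)"
      using \<open>0 \<le> c\<close> \<open>\<And>p. 0 \<le> x p\<close> diff by (intro always_eventually allI sqrt_integral_square_le) auto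
  qed (auto simp: set_lebesgue_integral_def intro!: always_eventually integral_nonneg)
qed

end
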